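(* Let $H$ be a group with a finite inverse-closed generating set $A$, let $G$ be a group containing $H$ as a subgroup of finite index, and let $S\subseteq G$ be a set of coset representatives for $G/H$ containing the identity $1$. Let $C:=A\cup(S\setminus\{1\})^{\pm1}$, a generating set of $G$. Then: (1) if $H$ is autostackable over $A$, then $G$ is autostackable over $C$; (2) if $H$ is stackable over $A$, then $G$ is stackable over $C$; (3) if $H$ is algorithmically stackable over $A$, then $G$ is algorithmically stackable over $C$.
   Context: Here $(S\setminus\{1\})^{\pm1}=\{s,s^{-1}\mid s\in S\setminus\{1\}\}$, viewed as a subset of $G$. "Coset representatives for $G/H$" means that $S$ contains exactly one element of each coset of $H$ in $G$; the paper uses the cosets $Hg$, so every element of $G$ is uniquely $hs$ with $h\in H$, $s\in S$. ($H$ is not assumed normal.) Conventions. All generating sets are finite and inverse-closed; no element of a generating set represents the identity, and distinct elements represent distinct group elements. $A^*$ is the set of all finite words over $A$; for $a\in A$, $a^{-1}$ denotes the letter of $A$ representing the inverse of $a$. Flow functions. Let $G$ be a group with finite inverse-closed generating set $A$ and Cayley graph $\Gamma=\Gamma(G,A)$. Let $\vec E$ be the set of directed edges and $\vec P$ the set of directed edge paths of $\Gamma$. For $g\in G$, $a\in A$, $e_{g,a}$ is the directed edge from $g$ to $ga$ labeled $a$; the directed edges $e_{g,a}$ and $e_{ga,a^{-1}}$ have the same underlying undirected edge. A flow function associated to a maximal tree $\mathcal T$ in $\Gamma$ is a function $\Phi:\vec E\to\vec P$ such that: (F1) for each $e\in\vec E$, the path $\Phi(e)$ has the same initial and terminal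 vertices as $e$; (F2d) if the undirected edge underlying $e$ lies in $\mathcal T$, then $\Phi(e)=e$; (F2r) the transitive closure $<_\Phi$ of the relation $<$ on $\vec E$, defined by $e'<e$ whenever $e'$ lies on the path $\Phi(e)$ and the undirected edges underlying both $e$ and $e'$ do not lie in $\mathcal T$, is a well-founded strict partial ordering. $\Phi$ is bounded if there is a constant $k$ such that for all $e\in\vec E$ the path $\Phi(e)$ has length at most $k$. Stacking map. For $g\in G$ let $y_g\in A^*$ be the label of the unique path without backtracking in $\mathcal T$ from the identity to $g$, and let $\mathcal N=\{y_g\mid g\in G\}$. The stacking map of $\Phi$ is $\phi:\mathcal N\times A\to A^*$, where $\phi(y_g,a)$ is the word labeling the path $\Phi(e_{g,a})$. Its graph is $graph(\phi)=\{(y_g,a,\phi(y_g,a))\mid g\in G,\ a\in A\}\subseteq (A^* )^3$. Definitions. $G$ is stackable over $A$ if there is a bounded flow function on a maximal tree in $\Gamma(G,A)$. $G$ is algorithmically stackable over $A$ if it has a bounded flow function for which $graph(\phi)$ is computable (a decidable set). $G$ is autostackable over $A$ if it has a bounded flow function for which $graph(\phi)$ is synchronously regular. Synchronously regular languages. Let $\$\notin A$ and let $A_n=(A\cup\{\$\})^n\setminus\{(\$,\dots,\$)\}$. For $u=(u_1,\dots,u_n)\in(A^* )^n$, append symbols $\$$ at the end of each $u_i$ to make all components have length $M=\max_i \ell(u_i)$, and let $\mu(u)\in A_n^*$ be the word of length $M$ whose $m$-th letter is the $n$-tuple of $m$-th letters of the padded components. A subset $L\subseteq(A^* )^n$ is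 synchronously regular if $\{\mu(u)\mid u\in L\}$ is a regular language over $A_n$. *)

theory Defs
  imports
    "HOL-Algebra.Coset"
    "HOL-Algebra.Generated_Groups"
    "HOL-Library.Nat_Bijection"
    "Graph_Theory.Digraph_Component"
begin

section \<open>Generating sets and Cayley graphs\<close>

text \<open>
  Letters are identified with the group elements they represent, so a generating set is a set
  of nontrivial group elements and a word is a list of group elements.
\<close>

definition generating_set :: "('a, 'b) monoid_scheme \<Rightarrow> 'a set \<Rightarrow> bool" where
  "generating_set G A \<longleftrightarrow>
     finite A \<and> A \<subseteq> carrier G - {\<one>\<^bsub>G\<^esub>} \<and> (\<forall>a\<in>A. inv\<^bsub>G\<^esub> a \<in> A) \<and> generate G A = carrier G"

text \<open>The arc \<open>(g, a)\<close> is the directed edge from \<open>g\<close> to \<open>ga\<close> with label \<open>a\<close>.\<close>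

definition cayley_graph :: "('a, 'b) monoid_scheme \<Rightarrow> 'a set \<Rightarrow> ('a, 'a \<times> 'a) pre_digraph" where
  "cayley_graph G A =
     \<lparr>verts = carrier G, arcs = carrier G \<times> A, tail = fst, head = (\<lambda>(g, a). g \<otimes>\<^bsub>G\<^esub> a)\<rparr>"

definition inverse_edge :: "('a, 'b) monoid_scheme \<Rightarrow> 'a \<times> 'a \<Rightarrow> 'a \<times> 'a" where
  "inverse_edge G e = (fst e \<otimes>\<^bsub>G\<^esub> snd e, inv\<^bsub>G\<^esub> (snd e))"

text \<open>
  The Cayley graph of a group over a generating set (in the above sense) has no loops and no
  parallel arcs.  Its undirected subgraphs are represented by subgraphs whose arc set is closed
  under reversal; thus the undirected edge underlying \<open>e\<close> lies in such a subgraph \<open>T\<close> iff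
  \<open>e \<in> arcs T\<close>.  The library predicate \<^const>\<open>tree\<close> is not suitable for symmetric digraphs, since
  it counts an arc followed by its reversal as a cycle; the bound \<open>3 \<le> length p\<close> excludes these
  degenerate cycles.
\<close>

definition undirected_tree :: "('a, 'b) pre_digraph \<Rightarrow> bool" where
  "undirected_tree T \<longleftrightarrow>
     symmetric T \<and> connected T \<and> \<not> (\<exists>p. pre_digraph.cycle T p \<and> 3 \<le> length p)"

definition maximal_tree :: "('a, 'b) pre_digraph \<Rightarrow> ('a, 'b) pre_digraph \<Rightarrow> bool" where
  "maximal_tree \<Gamma> T \<longleftrightarrow> pre_digraph.max_subgraph \<Gamma> undirected_tree T"


section \<open>Flow functions and stacking maps\<close>

definition flow_relation ::
    "('a, 'b) pre_digraph \<Rightarrow> ('a, 'b) pre_digraph \<Rightarrow> ('b \<Rightarrow> 'b list) \<Rightarrow> ('b \<times> 'b) set" where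
  "flow_relation \<Gamma> T \<Phi> =
     {(e', e). e \<in> arcs \<Gamma> - arcs T \<and> e' \<in> arcs \<Gamma> - arcs T \<and> e' \<in> set (\<Phi> e)}"

text \<open>
  In the last clause, transitivity is automatic and irreflexivity is implied by well-foundedness.
\<close>

definition flow_function ::
    "('a, 'b) pre_digraph \<Rightarrow> ('a, 'b) pre_digraph \<Rightarrow> ('b \<Rightarrow> 'b list) \<Rightarrow> bool" where
  "flow_function \<Gamma> T \<Phi> \<longleftrightarrow>
     (\<forall>e\<in>arcs \<Gamma>. pre_digraph.awalk \<Gamma> (tail \<Gamma> e) (\<Phi> e) (head \<Gamma> e)) \<and>
     (\<forall>e\<in>arcs \<Gamma>. e \<in> arcs T \<longrightarrow> \<Phi> e = [e]) \<and>
     wf ((flow_relation \<Gamma> T \<Phi>)\<^sup>+)"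

definition bounded_flow :: "('a, 'b) pre_digraph \<Rightarrow> ('b \<Rightarrow> 'b list) \<Rightarrow> bool" where
  "bounded_flow \<Gamma> \<Phi> \<longleftrightarrow> (\<exists>k. \<forall>e\<in>arcs \<Gamma>. length (\<Phi> e) \<le> k)"

text \<open>The word \<open>y\<^sub>g\<close>: the label of the path without backtracking in \<open>T\<close> from the identity to \<open>g\<close>.\<close>

definition tree_word ::
    "('a, 'b) monoid_scheme \<Rightarrow> ('a, 'a \<times> 'a) pre_digraph \<Rightarrow> 'a \<Rightarrow> 'a list" where
  "tree_word G T g =
     map snd (THE p. pre_digraph.awalk T \<one>\<^bsub>G\<^esub> p g \<and>
                     successively (\<lambda>e e'. e' \<noteq> inverse_edge G e) p)"

text \<open>Triples of words are lists of length 3; the letter \<open>a\<close> is the word \<open>[a]\<close>.\<close>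

definition stacking_graph ::
    "('a, 'b) monoid_scheme \<Rightarrow> 'a set \<Rightarrow> ('a, 'a \<times> 'a) pre_digraph \<Rightarrow>
      ('a \<times> 'a \<Rightarrow> ('a \<times> 'a) list) \<Rightarrow> 'a list list set" where
  "stacking_graph G A T \<Phi> =
     {[tree_word G T g, [a], map snd (\<Phi> (g, a))] | g a. g \<in> carrier G \<and> a \<in> A}"


section \<open>Synchronously regular languages\<close>

text \<open>
  \<open>L\<close> is the language accepted by some deterministic finite automaton over \<open>\<Sigma>\<close>.  States
  are natural numbers, which is no restriction for a finite state set.
\<close>

definition regular_language :: "'a set \<Rightarrow> 'a list set \<Rightarrow> bool" where
  "regular_language \<Sigma> L \<longleftrightarrow>
     (\<exists>(Q :: nat set) q0 F \<delta>.
        finite Q \<and> q0 \<in> Q \<and> F \<subseteq> Q \<and> (\<forall>q\<in>Q. \<forall>x\<in>\<Sigma>. \<delta> q x \<in> Q) \<and>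
        L = {w \<in> lists \<Sigma>. foldl \<delta> q0 w \<in> F})"

definition word_tuples :: "'a set \<Rightarrow> nat \<Rightarrow> 'a list list set" where
  "word_tuples A n = {us. length us = n \<and> set us \<subseteq> lists A}"

text \<open>The padding symbol \<open>$\<close> is \<^const>\<open>None\<close>.\<close>

definition padded_alphabet :: "'a set \<Rightarrow> nat \<Rightarrow> 'a option list set" where
  "padded_alphabet A n =
     {x. length x = n \<and> set x \<subseteq> insert None (Some ` A)} - {replicate n None}"

definition padded_word :: "'a list list \<Rightarrow> 'a option list list" where
  "padded_word us =
     map (\<lambda>m. map (\<lambda>u. if m < length u then Some (u ! m) else None) us)
       [0..<Max (length ` set us)]"

definition synchronously_regular :: "'a set \<Rightarrow> nat \<Rightarrow> 'a list list set \<Rightarrow> bool" where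
  "synchronously_regular A n L \<longleftrightarrow>
     L \<subseteq> word_tuples A n \<and> regular_language (padded_alphabet A n) (padded_word ` L)"


section \<open>Decidable sets of tuples of words\<close>

text \<open>
  \<open>recursive_fn n f\<close>: the restriction of \<open>f\<close> to lists of length \<open>n\<close> is a general (total)
  recursive \<open>n\<close>-ary function.  By Kleene's normal form theorem, admitting minimisation only when
  it yields a total function gives all total computable functions.  The last rule makes values
  on lists of other lengths irrelevant.
\<close>

inductive recursive_fn :: "nat \<Rightarrow> (nat list \<Rightarrow> nat) \<Rightarrow> bool" where
  zero: "recursive_fn n (\<lambda>xs. 0)"
| succ: "recursive_fn 1 (\<lambda>xs. Suc (xs ! 0))"
| proj: "i < n \<Longrightarrow> recursive_fn n (\<lambda>xs. xs ! i)"
| comp: "recursive_fn (length gs) f \<Longrightarrow> \<forall>g\<in>set gs. recursive_fn n g \<Longrightarrow>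
           recursive_fn n (\<lambda>xs. f (map (\<lambda>g. g xs) gs))"
| prim_rec: "recursive_fn n f \<Longrightarrow> recursive_fn (n + 2) g \<Longrightarrow>
           recursive_fn (Suc n)
             (\<lambda>xs. rec_nat (f (tl xs)) (\<lambda>k r. g (k # r # tl xs)) (hd xs))"
| minimise: "recursive_fn (Suc n) f \<Longrightarrow> \<forall>xs. length xs = n \<longrightarrow> (\<exists>k. f (k # xs) = 0) \<Longrightarrow>
           recursive_fn n (\<lambda>xs. LEAST k. f (k # xs) = 0)"
| restrict: "recursive_fn n f \<Longrightarrow> \<forall>xs. length xs = n \<longrightarrow> h xs = f xs \<Longrightarrow> recursive_fn n h"

text \<open>
  Words are coded by numbers after numbering the letters by \<open>c\<close>.  The alphabet is finite in all
  uses, so any two numberings are related by a computable translation of codes and the choice of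
  \<open>c\<close> is immaterial.
\<close>

definition decidable_words :: "'a set \<Rightarrow> nat \<Rightarrow> 'a list list set \<Rightarrow> bool" where
  "decidable_words A n L \<longleftrightarrow>
     L \<subseteq> word_tuples A n \<and>
     (\<exists>c f. inj_on c A \<and> recursive_fn n f \<and>
        (\<forall>us\<in>word_tuples A n.
           f (map (\<lambda>u. list_encode (map c u)) us) = (if us \<in> L then 1 else 0)))"


section \<open>Stackable groups\<close>

definition stackable :: "('a, 'b) monoid_scheme \<Rightarrow> 'a set \<Rightarrow> bool" where
  "stackable G A \<longleftrightarrow>
     (\<exists>T \<Phi>. maximal_tree (cayley_graph G A) T \<and> flow_function (cayley_graph G A) T \<Phi> \<and>
        bounded_flow (cayley_graph G A) \<Phi>)"

definition algorithmically_stackable :: "('a, 'b) monoid_scheme \<Rightarrow> 'a set \<Rightarrow> bool" where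
  "algorithmically_stackable G A \<longleftrightarrow>
     (\<exists>T \<Phi>. maximal_tree (cayley_graph G A) T \<and> flow_function (cayley_graph G A) T \<Phi> \<and>
        bounded_flow (cayley_graph G A) \<Phi> \<and>
        decidable_words A 3 (stacking_graph G A T \<Phi>))"

definition autostackable :: "('a, 'b) monoid_scheme \<Rightarrow> 'a set \<Rightarrow> bool" where
  "autostackable G A \<longleftrightarrow>
     (\<exists>T \<Phi>. maximal_tree (cayley_graph G A) T \<and> flow_function (cayley_graph G A) T \<Phi> \<and>
        bounded_flow (cayley_graph G A) \<Phi> \<and>
        synchronously_regular A 3 (stacking_graph G A T \<Phi>))"


section \<open>Coset representatives\<close>

text \<open>In HOL-Algebra, \<open>rcosets\<^bsub>G\<^esub> H\<close> is the set of the cosets \<open>Hg\<close>.\<close>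

definition coset_representatives :: "('a, 'b) monoid_scheme \<Rightarrow> 'a set \<Rightarrow> 'a set \<Rightarrow> bool" where
  "coset_representatives G H S \<longleftrightarrow>
     S \<subseteq> carrier G \<and> (\<forall>K \<in> rcosets\<^bsub>G\<^esub> H. \<exists>!s. s \<in> S \<and> s \<in> K)"

end

theory Submission
  imports Defs
begin

text \<open>
  Write \<open>y\<^bsub>h\<^esub>\<close> for the normal forms of \<open>H\<close>.  A tree for \<open>G\<close> is obtained from the tree for \<open>H\<close> by
  attaching every \<open>hs\<close> with \<open>1 \<noteq> s \<in> S\<close> as a leaf at \<open>h\<close>, so the normal form of \<open>hs\<close> is \<open>y\<^bsub>h\<^esub> s\<close>
  (\<open>tree_word_extended\<close>).  That the tree for \<open>H\<close> contains all of \<open>H\<close>, and that the new one is maximal,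
  rests on the elementary theory of trees: in a connected graph the maximal trees are the spanning ones,
  and reduced walks in a tree are unique.

  On the edges of the Cayley graph of \<open>H\<close> the flow is unchanged.  Any other edge starts at some
  \<open>hs\<close> and has a label \<open>c\<close>; writing \<open>sc = h't\<close> with \<open>h' \<in> H\<close> and \<open>t \<in> S\<close>, it is replaced by the path
  that goes back to \<open>h\<close>, follows a word over \<open>A\<close> for \<open>h'\<close>, and then goes to \<open>hh't\<close>.  The first
  and the last edge of the path are in the tree and the rest is in \<open>H\<close>, which gives well-foundedness
  (\<open>flow_extended\<close>).  The label of the path depends only on \<open>(s, c)\<close>, which gives boundedness.

  Therefore the stacking graph for \<open>G\<close> is the one for \<open>H\<close> together with finitely many sets of the form
  \<open>{(y\<^bsub>h\<^esub> s, c, w) | h \<in> H}\<close> with fixed \<open>s\<close>, \<open>c\<close> and \<open>w\<close> (\<open>stacking_graph_extended\<close>).  Boundedness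
  also shows that the set of normal forms of \<open>H\<close> is a finite union of sections of the stacking graph for
  \<open>H\<close>.  So it remains to see that regular and decidable languages are closed under finite unions,
  sections with fixed second and third components, the converse of sections, and appending a letter.
  For regular languages this follows from the criterion that there are only finitely many residuals, for
  decidable ones from the usual stock of recursive functions on codes of lists.
\<close>

section \<open>Undirected trees\<close>

text \<open>
  In a graph with an arc in each direction on every edge and no parallel arcs, an arc that returns
  to the vertex just left is the reversal of the preceding one, so these are the walks without
  backtracking.  Speaking of end points only, the notion does not mention labels and is inherited
  by subgraphs.
\<close>

definition (in pre_digraph) reduced :: "'b list \<Rightarrow> bool" where
  "reduced p \<longleftrightarrow> successively (\<lambda>e e'. head G e' \<noteq> tail G e) p"

lemma (in wf_digraph) connected_iff_strongly_connected:
  "symmetric G \<Longrightarrow> connected G \<longleftrightarrow> strongly_connected G"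
  by (simp add: connected_def strongly_connected_def reachable_mk_symmetric_eq)

lemma subgraph_loopfree:
  assumes "loopfree_digraph \<Gamma>" and sub: "subgraph T \<Gamma>"
  shows "loopfree_digraph T"
proof -
  interpret \<Gamma>: loopfree_digraph \<Gamma> by fact
  interpret T: wf_digraph T using sub by auto
  show ?thesis
    by unfold_locales (use sub \<Gamma>.no_loops in \<open>auto simp: subgraph_def compatible_def\<close>)
qed

lemma subgraph_nomulti:
  assumes "nomulti_digraph \<Gamma>" and sub: "subgraph T \<Gamma>"
  shows "nomulti_digraph T"
proof -
  interpret \<Gamma>: nomulti_digraph \<Gamma> by fact
  interpret T: wf_digraph T using sub by auto
  show ?thesis
  proof
    fix e e' assume "e \<in> arcs T" "e' \<in> arcs T" "arc_to_ends T e = arc_to_ends T e'"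
    then show "e = e'"
      using sub by (intro \<Gamma>.no_multi_arcs) (auto simp: subgraph_def compatible_def arc_to_ends_def)
  qed
qed

locale simple_tree = loopfree_digraph + nomulti_digraph +
  assumes undirected_tree: "undirected_tree G"
begin

lemma tree_symmetric: "symmetric G"
  using undirected_tree by (simp add: undirected_tree_def)

text \<open>
  The first return of a walk to its initial vertex is a cycle.  In a tree it has length at most 2;
  length 1 is a loop, and length 2 is a backtracking.
\<close>

lemma reduced_imp_distinct:
  assumes "awalk u p v" and "reduced p"
  shows "distinct (awalk_verts u p)"
  using assms
proof (induction p arbitrary: u)
  case (Cons e q)
  have e: "e \<in> arcs G" "tail G e = u" "awalk (head G e) q v"
    using Cons.prems(1) by (auto simp: awalk_Cons_iff)
  have distinct: "distinct (awalk_verts (head G e) q)"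
    using Cons.IH[OF e(3)] Cons.prems(2) by (auto simp: reduced_def successively_Cons)
  have "u \<notin> set (awalk_verts (head G e) q)"
  proof
    assume "u \<in> set (awalk_verts (head G e) q)"
    then obtain q1 q2 where q: "q = q1 @ q2" and q1: "awalk (head G e) q1 u"
      using awalk_decomp[OF e(3)] by blast
    have "distinct (awalk_verts (head G e) q1)"
      using distinct e(3) by (simp add: q awalk_verts_append del: awalk_append_iff)
    then have "cycle (e # q1)"
      unfolding cycle_def using e q1 by (intro exI[of _ u]) (simp add: awalk_Cons_iff)
    then have "length (e # q1) < 3"
      using undirected_tree by (auto simp: undirected_tree_def not_le)
    moreover have "q1 \<noteq> []"
      using q1 no_loops[OF e(1)] e(2) by (auto simp: awalk_Nil_iff)
    ultimately obtain f where "q1 = [f]"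
      by (cases q1) auto
    then show False
      using q1 Cons.prems(2) e(2) by (auto simp: q reduced_def awalk_Cons_iff awalk_Nil_iff)
  qed
  then show ?case using distinct e(2) by simp
qed simp

definition rev_arc :: "'b \<Rightarrow> 'b" where
  "rev_arc e = (SOME e'. e' \<in> arcs G \<and> tail G e' = head G e \<and> head G e' = tail G e)"

lemma rev_arc:
  assumes "e \<in> arcs G"
  shows "rev_arc e \<in> arcs G" "tail G (rev_arc e) = head G e" "head G (rev_arc e) = tail G e"
proof -
  have "\<exists>e'. e' \<in> arcs G \<and> tail G e' = head G e \<and> head G e' = tail G e"
    using tree_symmetric assms by (force simp: symmetric_conv)
  from someI_ex[OF this]
  show "rev_arc e \<in> arcs G" "tail G (rev_arc e) = head G e" "head G (rev_arc e) = tail G e"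
    by (auto simp: rev_arc_def)
qed

lemma awalk_rev: "awalk u p v \<Longrightarrow> awalk v (rev (map rev_arc p)) u"
proof (induction p arbitrary: u)
  case (Cons e p)
  then have "e \<in> arcs G" "tail G e = u" "awalk v (rev (map rev_arc p)) (head G e)"
    by (auto simp: awalk_Cons_iff)
  moreover from this have "awalk (head G e) [rev_arc e] u"
    by (auto simp: awalk_Cons_iff awalk_Nil_iff rev_arc)
  ultimately show ?case by (auto intro: awalk_appendI)
qed (auto simp: awalk_Nil_iff)

lemma reduced_rev: "set p \<subseteq> arcs G \<Longrightarrow> reduced p \<Longrightarrow> reduced (rev (map rev_arc p))"
  unfolding reduced_def successively_rev successively_map
  by (induction p rule: induct_list012) (auto simp: rev_arc)

text \<open>
  Two reduced walks with common ends that begin with different arcs combine, the first one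
  reversed, to a nonempty closed reduced walk; but the vertices of a reduced walk are distinct.
\<close>

lemma reduced_unique:
  assumes "awalk u p v" "reduced p" and "awalk u q v" "reduced q"
  shows "p = q"
  using assms
proof (induction p arbitrary: u q)
  case Nil
  then have "u = v" by (simp add: awalk_Nil_iff)
  then have "\<not> q \<noteq> []"
    using apath_nonempty_ends[of u q v] reduced_imp_distinct[OF Nil(3,4)] Nil(3)
    by (auto simp: apath_def)
  then show ?case by simp
next
  case (Cons e p)
  show ?case
  proof (cases q)
    case Nil
    then have "u = v" using Cons.prems by (simp add: awalk_Nil_iff)
    then show ?thesis
      using apath_nonempty_ends[of u "e # p" v] reduced_imp_distinct[OF Cons.prems(1,2)] Cons.prems(1)
      by (auto simp: apath_def)
  next
    case (Cons f q')
    have e: "e \<in> arcs G" "tail G e = u" "awalk (head G e) p v" "reduced p"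
      using \<open>awalk u (e # p) v\<close> \<open>reduced (e # p)\<close>
      by (auto simp: awalk_Cons_iff reduced_def successively_Cons)
    have f: "f \<in> arcs G" "tail G f = u" "awalk (head G f) q' v" "reduced q'"
      using \<open>awalk u q v\<close> \<open>reduced q\<close> Cons
      by (auto simp: awalk_Cons_iff reduced_def successively_Cons)
    show ?thesis
    proof (cases "e = f")
      case True
      then show ?thesis using Cons.IH[OF e(3,4)] f(3,4) Cons by simp
    next
      case False
      then have heads: "head G f \<noteq> head G e"
        using no_multi_arcs[OF e(1) f(1)] e(2) f(2) by (auto simp: arc_to_ends_def)
      let ?r = "rev (map rev_arc (e # p)) @ q"
      have walk: "awalk v ?r v"
        using awalk_rev[OF \<open>awalk u (e # p) v\<close>] \<open>awalk u q v\<close> by (rule awalk_appendI)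
      have "reduced ?r"
      proof -
        have "set (e # p) \<subseteq> arcs G" using \<open>awalk u (e # p) v\<close> unfolding awalk_def by blast
        then have "reduced (rev (map rev_arc (e # p)))"
          using \<open>reduced (e # p)\<close> by (rule reduced_rev)
        moreover have "head G (hd q) \<noteq> tail G (last (rev (map rev_arc (e # p))))"
          using heads rev_arc(2)[OF e(1)] Cons by simp
        ultimately show ?thesis
          using \<open>reduced q\<close> unfolding reduced_def successively_append_iff by simp
      qed
      then have "distinct (awalk_verts v ?r)" by (rule reduced_imp_distinct[OF walk])
      then have "apath v ?r v" using walk unfolding apath_def by blast
      then show ?thesis using apath_nonempty_ends[of v ?r v] by simp
    qed
  qed
qed

lemma distinct_imp_reduced:
  "awalk u p v \<Longrightarrow> distinct (awalk_verts u p) \<Longrightarrow> reduced p"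
proof (induction p arbitrary: u)
  case (Cons e p)
  have e: "tail G e = u" "awalk (head G e) p v" "u \<notin> set (awalk_verts (head G e) p)" "reduced p"
    using Cons by (auto simp: awalk_Cons_iff)
  show ?case
  proof (cases p)
    case (Cons f q)
    have "head G f \<in> set (awalk_verts (head G f) q)" by (cases q) (use e(2) Cons in \<open>auto simp: awalk_Cons_iff\<close>)
    then have "head G f \<noteq> u" using e(3) Cons by auto
    then show ?thesis using e(1,4) Cons by (simp add: reduced_def)
  qed (simp add: reduced_def)
qed (simp add: reduced_def)

lemma ex_reduced:
  assumes "u \<in> verts G" and "v \<in> verts G"
  shows "\<exists>p. awalk u p v \<and> reduced p"
proof -
  have "strongly_connected G"
    using undirected_tree connected_iff_strongly_connected by (auto simp: undirected_tree_def)
  then have "u \<rightarrow>\<^sup>* v" using assms by (auto simp: strongly_connected_def)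
  then obtain p where "apath u p v" by (auto simp: reachable_apath)
  then show ?thesis using distinct_imp_reduced by (auto simp: apath_def)
qed

end

lemma (in wf_digraph) awalk_consecutive:
  "awalk u p v \<Longrightarrow> Suc i < length p \<Longrightarrow> tail G (p ! Suc i) = head G (p ! i)"
proof (induction p arbitrary: u i)
  case (Cons e p)
  then have walk: "awalk (head G e) p v" by (auto simp: awalk_Cons_iff)
  show ?case
  proof (cases i)
    case 0
    then show ?thesis using walk Cons.prems(2) by (cases p) (auto simp: awalk_Cons_iff)
  next
    case (Suc j)
    then show ?thesis using Cons.IH[OF walk, of j] Cons.prems(2) by simp
  qed
qed simp

lemma (in wf_digraph) closed_awalk_consecutive:
  assumes walk: "awalk u p u" and i: "i < length p"
  shows "tail G (p ! (Suc i mod length p)) = head G (p ! i)"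
proof (cases "Suc i < length p")
  case True
  then show ?thesis using awalk_consecutive[OF walk] by simp
next
  case False
  then have last: "Suc i = length p" using i by simp
  have "p \<noteq> []" using i by auto
  then have "tail G (hd p) = u" "head G (last p) = u"
    using walk awalk_verts_conv[of u p] by (auto simp: awalk_conv hd_append hd_map split: if_splits)
  then have "tail G (p ! 0) = head G (p ! (length p - 1))"
    using \<open>p \<noteq> []\<close> by (simp add: hd_conv_nth last_conv_nth)
  moreover have "Suc i mod length p = 0" "i = length p - 1" using last by auto
  ultimately show ?thesis by simp
qed

text \<open>
  The vertex \<open>f v\<close> is the only neighbour of a new vertex \<open>v\<close>.  On a cycle through \<open>v\<close> both the
  predecessor and the successor of \<open>v\<close> would thus be \<open>f v\<close>, which forces the length to be 2.  So a
  longer cycle avoids all new vertices, and it was a cycle before.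
\<close>

lemma undirected_tree_attach_leaves:
  assumes T: "undirected_tree T" and sub: "subgraph T T'" and sym: "symmetric T'"
    and leaf: "\<And>e. e \<in> arcs T' - arcs T \<Longrightarrow>
      (tail T' e \<in> verts T \<and> head T' e \<notin> verts T \<and> tail T' e = f (head T' e)) \<or>
      (head T' e \<in> verts T \<and> tail T' e \<notin> verts T \<and> head T' e = f (tail T' e))"
    and attached: "\<And>v. v \<in> verts T' - verts T \<Longrightarrow> \<exists>e\<in>arcs T'. tail T' e = v"
  shows "undirected_tree T'"
proof -
  interpret T: wf_digraph T using sub by auto
  interpret T': wf_digraph T' using sub by auto
  have ends[simp]: "tail T = tail T'" "head T = head T'"
    using sub by (auto simp: subgraph_def compatible_def)
  have "strongly_connected T"
    using T T.connected_iff_strongly_connected by (auto simp: undirected_tree_def)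
  then have nonempty: "verts T \<noteq> {}"
    and reach: "\<And>u v. u \<in> verts T \<Longrightarrow> v \<in> verts T \<Longrightarrow> u \<rightarrow>\<^sup>*\<^bsub>T'\<^esub> v"
    by (auto simp: strongly_connected_def intro: T'.reachable_mono[OF _ sub])
  have to_T: "\<exists>u\<in>verts T. v \<rightarrow>\<^sup>*\<^bsub>T'\<^esub> u" if v: "v \<in> verts T'" for v
  proof (cases "v \<in> verts T")
    case False
    then obtain e where e: "e \<in> arcs T'" "tail T' e = v" using attached v by blast
    then have "e \<notin> arcs T" using T.tail_in_verts[of e] False by auto
    then have "head T' e \<in> verts T" using leaf[of e] e False by auto
    moreover have "v \<rightarrow>\<^bsub>T'\<^esub> head T' e" using T'.in_arcs_imp_in_arcs_ends[OF e(1)] e(2) by simp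
    ultimately show ?thesis using T'.reachable_adjI by blast
  qed (use v in auto)
  have "strongly_connected T'"
  proof
    show "verts T' \<noteq> {}" using nonempty sub by auto
    fix u v assume "u \<in> verts T'" "v \<in> verts T'"
    then obtain u' v' where "u' \<in> verts T" "u \<rightarrow>\<^sup>*\<^bsub>T'\<^esub> u'" "v' \<in> verts T" "v \<rightarrow>\<^sup>*\<^bsub>T'\<^esub> v'"
      using to_T by meson
    then show "u \<rightarrow>\<^sup>*\<^bsub>T'\<^esub> v"
      using reach T'.reachable_trans symmetric_reachable[OF sym] by meson
  qed
  then have "connected T'" using sym T'.connected_iff_strongly_connected by blast
  moreover have "\<not> (pre_digraph.cycle T' p \<and> 3 \<le> length p)" for p
  proof
    assume p: "pre_digraph.cycle T' p \<and> 3 \<le> length p"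
    then obtain u where walk: "T'.awalk u p u" and dist: "distinct (tl (T'.awalk_verts u p))"
      by (auto simp: T'.cycle_def)
    have n: "3 \<le> length p" using p by simp
    let ?n = "length p"
    have heads: "distinct (map (head T') p)"
      using dist T'.awalk_verts_conv'[of u p u] walk n by (auto simp: T'.awalk_def split: if_splits)
    have next_arc: "tail T' (p ! (Suc i mod ?n)) = head T' (p ! i)" if "i < ?n" for i
      using T'.closed_awalk_consecutive[OF walk that] .
    have pred: "\<exists>k<?n. Suc k mod ?n = i" if "i < ?n" for i
    proof (cases i)
      case 0
      have "Suc (?n - 1) = ?n" using n by simp
      then have "Suc (?n - 1) mod ?n = i" by (simp only: mod_self 0)
      then show ?thesis using n by (intro exI[of _ "?n - 1"]) simp
    next
      case (Suc j)
      then show ?thesis using that by (intro exI[of _ j]) simp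
    qed
    have arcs: "p ! i \<in> arcs T'" if "i < ?n" for i
      using walk that by (auto simp: T'.awalk_def)
    have head_old: "head T' (p ! i) \<in> verts T" if i: "i < ?n" for i
    proof (rule ccontr)
      assume new: "head T' (p ! i) \<notin> verts T"
      \<comment> \<open>The arcs at the positions \<open>k\<close>, \<open>i\<close>, \<open>j\<close> follow each other cyclically, and the new vertex is
        the head of the middle one.  Its only neighbour is then the head of both outer ones.\<close>
      define j where "j = Suc i mod ?n"
      have j: "j < ?n" unfolding j_def by (rule mod_less_divisor) (use n in linarith)
      obtain k where k: "k < ?n" "Suc k mod ?n = i" using pred[OF i] by blast
      have "p ! i \<notin> arcs T" using new T.head_in_verts by auto
      then have "tail T' (p ! i) = f (head T' (p ! i))" using leaf[of "p ! i"] arcs[OF i] new by auto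
      moreover have tail_j: "tail T' (p ! j) = head T' (p ! i)" using next_arc[OF i] by (simp add: j_def)
      then have "p ! j \<notin> arcs T" using new T.tail_in_verts[of "p ! j"] by auto
      then have "head T' (p ! j) = f (tail T' (p ! j))" using leaf[of "p ! j"] arcs[OF j] new tail_j by auto
      ultimately have "head T' (p ! j) = head T' (p ! k)" using next_arc[OF k(1)] k(2) tail_j by simp
      then have "map (head T') p ! j = map (head T') p ! k" using j k(1) by simp
      then have "j = k" using heads j k(1) by (simp add: nth_eq_iff_index_eq del: nth_map)
      then have "Suc (Suc i mod ?n) mod ?n = i" using k(2) by (simp add: j_def)
      then have "(i + 2) mod ?n = i" by (simp add: mod_Suc_eq)
      moreover have "i mod ?n = i" using i by simp
      ultimately have "(i + 2) mod ?n = (i + 0) mod ?n" by simp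
      then have "?n dvd 2" using mod_eq_dvd_iff_nat[of i "i + 2" ?n] by simp
      then show False using n by (auto dest: dvd_imp_le)
    qed
    have tail_old: "tail T' (p ! i) \<in> verts T" if i: "i < ?n" for i
      using pred[OF i] next_arc head_old by metis
    have "p ! i \<in> arcs T" if i: "i < ?n" for i
      using leaf[of "p ! i"] arcs[OF i] head_old[OF i] tail_old[OF i] by blast
    then have "set p \<subseteq> arcs T" by (auto simp: in_set_conv_nth)
    moreover have "u \<in> verts T"
      using tail_old[of 0] walk n by (cases p) (auto simp: T'.awalk_Cons_iff)
    ultimately have "T.awalk u p u"
      using walk sub compatible_cas[of T' T] by (auto simp: T.awalk_def T'.awalk_def)
    moreover have "T.awalk_verts = T'.awalk_verts"
      using sub by (intro compatible_awalk_verts) (auto simp: compatible_def)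
    ultimately have "T.cycle p" using dist n by (auto simp: T.cycle_def)
    then show False using T n by (auto simp: undirected_tree_def)
  qed
  ultimately show ?thesis using sym by (auto simp: undirected_tree_def)
qed

text \<open>
  If a vertex were missing, then some edge of the connected graph would leave the tree, and it
  could be attached as a leaf.
\<close>

lemma maximal_tree_spanning:
  assumes sym: "symmetric \<Gamma>" and conn: "strongly_connected \<Gamma>" and max: "maximal_tree \<Gamma> T"
  shows "verts T = verts \<Gamma>"
proof (rule ccontr)
  assume neq: "verts T \<noteq> verts \<Gamma>"
  have sub: "subgraph T \<Gamma>" and tree: "undirected_tree T"
    and none: "\<And>T'. T' \<noteq> T \<Longrightarrow> subgraph T T' \<Longrightarrow> subgraph T' \<Gamma> \<Longrightarrow> \<not> undirected_tree T'"
    using max by (auto simp: maximal_tree_def pre_digraph.max_subgraph_def)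
  interpret \<Gamma>: wf_digraph \<Gamma> using sub by auto
  interpret T: wf_digraph T using sub by auto
  have ends[simp]: "tail T = tail \<Gamma>" "head T = head \<Gamma>"
    using sub by (auto simp: subgraph_def compatible_def)
  have sub_verts: "verts T \<subseteq> verts \<Gamma>" "arcs T \<subseteq> arcs \<Gamma>" using sub by auto
  have "strongly_connected T"
    using tree T.connected_iff_strongly_connected by (auto simp: undirected_tree_def)
  then obtain u v where u: "u \<in> verts T" and v: "v \<in> verts \<Gamma>" "v \<notin> verts T"
    using neq sub_verts by (auto simp: strongly_connected_def)
  have "u \<rightarrow>\<^sup>*\<^bsub>\<Gamma>\<^esub> v" using u v sub_verts conn by (auto simp: strongly_connected_def)
  then have "v \<notin> verts T \<longrightarrow> (\<exists>x y. x \<in> verts T \<and> y \<notin> verts T \<and> x \<rightarrow>\<^bsub>\<Gamma>\<^esub> y)"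
    by (induction rule: \<Gamma>.reachable_induct) (use u in auto)
  then obtain e where e: "e \<in> arcs \<Gamma>" "tail \<Gamma> e \<in> verts T" "head \<Gamma> e \<notin> verts T"
    using v by (auto simp: arcs_ends_conv)
  obtain e' where e': "e' \<in> arcs \<Gamma>" "tail \<Gamma> e' = head \<Gamma> e" "head \<Gamma> e' = tail \<Gamma> e"
    using sym e(1) by (force simp: symmetric_conv)
  define T' where "T' = \<lparr>verts = insert (head \<Gamma> e) (verts T), arcs = {e, e'} \<union> arcs T,
    tail = tail \<Gamma>, head = head \<Gamma>\<rparr>"
  have T'_simps[simp]: "verts T' = insert (head \<Gamma> e) (verts T)" "arcs T' = {e, e'} \<union> arcs T"
    "tail T' = tail \<Gamma>" "head T' = head \<Gamma>"
    by (simp_all add: T'_def)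
  have T_ends: "tail \<Gamma> a \<in> verts T" "head \<Gamma> a \<in> verts T" if "a \<in> arcs T" for a
    using T.tail_in_verts[OF that] T.head_in_verts[OF that] by simp_all
  have "wf_digraph T'"
    by unfold_locales (use e e' T_ends in auto)
  then have T'_sub: "subgraph T' \<Gamma>" and T_sub: "subgraph T T'"
    using sub_verts e e' \<Gamma>.wf_digraph T.wf_digraph by (auto simp: subgraph_def compatible_def)
  have "undirected_tree T'"
  proof (rule undirected_tree_attach_leaves[OF tree T_sub, where f = "\<lambda>_. tail \<Gamma> e"])
    have "\<exists>b\<in>arcs T. tail \<Gamma> a = head \<Gamma> b \<and> head \<Gamma> a = tail \<Gamma> b" if "a \<in> arcs T" for a
      using tree that by (auto simp: undirected_tree_def symmetric_conv)
    then show "symmetric T'" using e' by (auto simp: symmetric_conv)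
  qed (use e e' in auto)
  moreover have "T' \<noteq> T" using e(3) by (metis T'_simps(1) insertI1)
  ultimately show False using none T_sub T'_sub by blast
qed

text \<open>
  An additional arc would be a second reduced walk between two vertices that are already joined by
  a reduced walk in the smaller tree.
\<close>

lemma spanning_tree_maximal:
  assumes loopfree: "loopfree_digraph \<Gamma>" and nomulti: "nomulti_digraph \<Gamma>"
    and sub: "subgraph T \<Gamma>" and tree: "undirected_tree T" and span: "verts T = verts \<Gamma>"
  shows "maximal_tree \<Gamma> T"
  unfolding maximal_tree_def pre_digraph.max_subgraph_def
proof (intro conjI allI impI sub tree notI)
  fix T' assume T': "T' \<noteq> T \<and> subgraph T T'" and "subgraph T' \<Gamma> \<and> undirected_tree T'"
  then have sub': "subgraph T' \<Gamma>" "undirected_tree T'" "subgraph T T'" "T' \<noteq> T" by auto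
  interpret T': simple_tree T'
    using subgraph_loopfree[OF loopfree sub'(1)] subgraph_nomulti[OF nomulti sub'(1)] sub'(2)
    by (simp add: simple_tree_def simple_tree_axioms_def)
  interpret T: simple_tree T
    using subgraph_loopfree[OF loopfree sub] subgraph_nomulti[OF nomulti sub] tree
    by (simp add: simple_tree_def simple_tree_axioms_def)
  have ends: "tail T = tail T'" "head T = head T'" "arcs T \<subseteq> arcs T'"
    using sub'(3) by (auto simp: subgraph_def compatible_def)
  have verts: "verts T = verts T'" using span sub'(1,3) by (auto simp: subgraph_def)
  have "arcs T' \<subseteq> arcs T"
  proof
    fix e assume e: "e \<in> arcs T'"
    then obtain p where p: "T.awalk (tail T' e) p (head T' e)" "T.reduced p"
      using T.ex_reduced verts by force
    then have "T'.awalk (tail T' e) p (head T' e)" "T'.reduced p"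
      using T'.subgraph_awalk_imp_awalk[OF _ sub'(3)] ends by (auto simp: T.reduced_def T'.reduced_def)
    moreover have "T'.awalk (tail T' e) [e] (head T' e)" "T'.reduced [e]"
      using e by (auto simp: T'.awalk_Cons_iff T'.awalk_Nil_iff T'.reduced_def)
    ultimately have "p = [e]" by (rule T'.reduced_unique)
    then show "e \<in> arcs T" using p(1) by (auto simp: T.awalk_Cons_iff)
  qed
  then have "T' = T" using ends verts by (intro pre_digraph.equality) auto
  then show False using sub'(4) by simp
qed

section \<open>Cayley graphs\<close>

lemma cayley_graph_simps:
  "verts (cayley_graph G A) = carrier G" "arcs (cayley_graph G A) = carrier G \<times> A"
  "tail (cayley_graph G A) = fst" "head (cayley_graph G A) = (\<lambda>(g, a). g \<otimes>\<^bsub>G\<^esub> a)"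
  by (simp_all add: cayley_graph_def)

text \<open>
  The path in the Cayley graph that starts at \<open>g\<close> and has label \<open>w\<close>; it ends at
  \<open>foldl (\<otimes>) g w\<close>.
\<close>

primrec edge_path :: "('a, 'b) monoid_scheme \<Rightarrow> 'a \<Rightarrow> 'a list \<Rightarrow> ('a \<times> 'a) list" where
  "edge_path G g [] = []"
| "edge_path G g (a # w) = (g, a) # edge_path G (g \<otimes>\<^bsub>G\<^esub> a) w"

lemma map_snd_edge_path: "map snd (edge_path G g w) = w"
  by (induction w arbitrary: g) auto

lemma length_edge_path: "length (edge_path G g w) = length w"
  by (induction w arbitrary: g) auto

lemma edge_path_append:
  "edge_path G g (u @ v) = edge_path G g u @ edge_path G (foldl (\<otimes>\<^bsub>G\<^esub>) g u) v"
  by (induction u arbitrary: g) auto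

context group
begin

lemma foldl_mult_closed:
  "g \<in> carrier G \<Longrightarrow> set w \<subseteq> carrier G \<Longrightarrow> foldl (\<otimes>) g w \<in> carrier G"
  by (induction w arbitrary: g) auto

lemma foldl_mult_factor:
  "g \<in> carrier G \<Longrightarrow> set w \<subseteq> carrier G \<Longrightarrow> foldl (\<otimes>) g w = g \<otimes> foldl (\<otimes>) \<one> w"
proof (induction w rule: rev_induct)
  case (snoc a w)
  then show ?case using foldl_mult_closed[of \<one> w] by (simp add: m_assoc)
qed simp

lemma generate_imp_word:
  assumes "h \<in> generate G A" and A: "A \<subseteq> carrier G" and inv: "\<forall>a\<in>A. inv a \<in> A"
  shows "\<exists>w\<in>lists A. foldl (\<otimes>) \<one> w = h"
  using assms(1)
proof (induction rule: generate.induct)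
  case one
  show ?case by (rule bexI[of _ "[]"]) auto
next
  case (incl a)
  then show ?case using A by (intro bexI[of _ "[a]"]) auto
next
  case (inv a)
  then show ?case using A assms(3) by (intro bexI[of _ "[inv a]"]) auto
next
  case (eng g h)
  then obtain u v where "u \<in> lists A" "foldl (\<otimes>) \<one> u = g" "v \<in> lists A" "foldl (\<otimes>) \<one> v = h"
    by blast
  moreover from this have "foldl (\<otimes>) g v = g \<otimes> h"
    using A foldl_mult_factor[of g v] foldl_mult_closed[of \<one> u] by auto
  ultimately show ?case by (intro bexI[of _ "u @ v"]) auto
qed

lemma cayley_wf: "A \<subseteq> carrier G \<Longrightarrow> wf_digraph (cayley_graph G A)"
  by unfold_locales (auto simp: cayley_graph_simps)

lemma cayley_loopfree:
  assumes "A \<subseteq> carrier G - {\<one>}"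
  shows "loopfree_digraph (cayley_graph G A)"
proof -
  interpret wf_digraph "cayley_graph G A" using assms by (intro cayley_wf) auto
  show ?thesis
  proof
    fix e assume "e \<in> arcs (cayley_graph G A)"
    then obtain g a where e: "e = (g, a)" "g \<in> carrier G" "a \<in> A"
      by (auto simp: cayley_graph_simps)
    then have "a \<in> carrier G" "a \<noteq> \<one>" using assms by auto
    then have "g \<noteq> g \<otimes> a" using e(2) l_cancel_one' by blast
    then show "tail (cayley_graph G A) e \<noteq> head (cayley_graph G A) e"
      by (simp add: e cayley_graph_simps)
  qed
qed

lemma cayley_nomulti:
  assumes "A \<subseteq> carrier G"
  shows "nomulti_digraph (cayley_graph G A)"
proof -
  interpret wf_digraph "cayley_graph G A" using assms by (rule cayley_wf)
  show ?thesis
  proof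
    fix e e' assume "e \<in> arcs (cayley_graph G A)" "e' \<in> arcs (cayley_graph G A)"
      and eq: "arc_to_ends (cayley_graph G A) e = arc_to_ends (cayley_graph G A) e'"
    then have "fst e \<in> carrier G" "snd e \<in> carrier G" "snd e' \<in> carrier G"
      using assms by (auto simp: cayley_graph_simps)
    moreover have "fst e = fst e'" "fst e \<otimes> snd e = fst e \<otimes> snd e'"
      using eq by (auto simp: arc_to_ends_def cayley_graph_simps case_prod_beta)
    ultimately have "snd e = snd e'" by simp
    with \<open>fst e = fst e'\<close> show "e = e'" by (rule prod_eqI)
  qed
qed

lemma awalk_edge_path:
  assumes A: "A \<subseteq> carrier G" and g: "g \<in> carrier G" and w: "w \<in> lists A"
  shows "pre_digraph.awalk (cayley_graph G A) g (edge_path G g w) (foldl (\<otimes>) g w)"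
proof -
  interpret wf_digraph "cayley_graph G A" using A by (rule cayley_wf)
  show ?thesis
    using g w
  proof (induction w arbitrary: g)
    case (Cons a w)
    then have "a \<in> A" "g \<otimes> a \<in> carrier G" using A by auto
    then show ?case using Cons by (auto simp: awalk_Cons_iff cayley_graph_simps)
  qed (simp add: awalk_Nil_iff cayley_graph_simps)
qed

lemma cayley_symmetric:
  assumes "A \<subseteq> carrier G" and "\<forall>a\<in>A. inv a \<in> A"
  shows "symmetric (cayley_graph G A)"
  unfolding symmetric_conv
proof
  fix e assume "e \<in> arcs (cayley_graph G A)"
  then have "inverse_edge G e \<in> arcs (cayley_graph G A)
      \<and> tail (cayley_graph G A) e = head (cayley_graph G A) (inverse_edge G e)
      \<and> head (cayley_graph G A) e = tail (cayley_graph G A) (inverse_edge G e)"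
    using assms by (auto simp: cayley_graph_simps inverse_edge_def m_assoc subset_eq)
  then show "\<exists>e'\<in>arcs (cayley_graph G A). tail (cayley_graph G A) e = head (cayley_graph G A) e'
      \<and> head (cayley_graph G A) e = tail (cayley_graph G A) e'" by blast
qed

lemma cayley_strongly_connected:
  assumes "generating_set G A"
  shows "strongly_connected (cayley_graph G A)"
proof
  have A: "A \<subseteq> carrier G" "\<forall>a\<in>A. inv a \<in> A" "generate G A = carrier G"
    using assms by (auto simp: generating_set_def)
  interpret wf_digraph "cayley_graph G A" using A(1) by (rule cayley_wf)
  show "verts (cayley_graph G A) \<noteq> {}" by (auto simp: cayley_graph_simps)
  fix g h assume "g \<in> verts (cayley_graph G A)" "h \<in> verts (cayley_graph G A)"
  then have gh: "g \<in> carrier G" "h \<in> carrier G" by (simp_all add: cayley_graph_simps)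
  then have "inv g \<otimes> h \<in> generate G A" using A(3) by simp
  then obtain w where w: "w \<in> lists A" "foldl (\<otimes>) \<one> w = inv g \<otimes> h"
    using generate_imp_word[OF _ A(1,2)] by blast
  then have "foldl (\<otimes>) g w = h"
    using foldl_mult_factor[OF gh(1), of w] A(1) gh by (auto simp: m_assoc[symmetric])
  then have "awalk g (edge_path G g w) h" using awalk_edge_path[OF A(1) gh(1) w(1)] by simp
  then show "g \<rightarrow>\<^sup>*\<^bsub>cayley_graph G A\<^esub> h" by (rule reachable_awalkI)
qed

lemma simple_tree_cayley:
  assumes A: "A \<subseteq> carrier G - {\<one>}" and sub: "subgraph T (cayley_graph G A)"
    and tree: "undirected_tree T"
  shows "simple_tree T"
proof -
  have "A \<subseteq> carrier G" using A by blast
  then show ?thesis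
    using subgraph_loopfree[OF cayley_loopfree[OF A] sub] subgraph_nomulti[OF cayley_nomulti sub] tree
    by (simp add: simple_tree_def simple_tree_axioms_def)
qed

text \<open>
  This translates backtracking as it appears in the definition of \<^const>\<open>tree_word\<close>, which refers to
  labels, into the label-free notion for which uniqueness was proved.
\<close>

lemma reduced_cayley_iff:
  assumes A: "A \<subseteq> carrier G" and sub: "subgraph T (cayley_graph G A)"
    and walk: "pre_digraph.awalk T g p h"
  shows "pre_digraph.reduced T p \<longleftrightarrow> successively (\<lambda>e e'. e' \<noteq> inverse_edge G e) p"
proof -
  interpret T: wf_digraph T using sub by auto
  have ends: "tail T = fst" "head T = (\<lambda>(g, a). g \<otimes> a)" "arcs T \<subseteq> carrier G \<times> A"
    using sub by (auto simp: subgraph_def compatible_def cayley_graph_simps)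
  have backtrack: "head T e' \<noteq> tail T e \<longleftrightarrow> e' \<noteq> inverse_edge G e"
    if arcs: "e \<in> arcs T" "e' \<in> arcs T" and consecutive: "tail T e' = head T e" for e e'
  proof -
    obtain g a b where e: "e = (g, a)" "e' = (g \<otimes> a, b)"
      using consecutive by (cases e; cases e') (auto simp: ends)
    then have carr: "g \<in> carrier G" "a \<in> carrier G" "b \<in> carrier G" using arcs ends(3) A by auto
    have "g \<otimes> a \<otimes> b = g \<longleftrightarrow> g \<otimes> (a \<otimes> b) = g \<otimes> \<one>" using carr by (simp add: m_assoc)
    also have "\<dots> \<longleftrightarrow> a \<otimes> b = \<one>" using carr by simp
    also have "\<dots> \<longleftrightarrow> b = inv a"
      using carr inv_equality[of b a] inv_comm[of a b] by auto
    finally show ?thesis by (simp add: e ends inverse_edge_def)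
  qed
  show ?thesis
    using walk
  proof (induction p arbitrary: g rule: induct_list012)
    case (3 e e' p)
    then have "e \<in> arcs T" "e' \<in> arcs T" "tail T e' = head T e" "T.awalk (head T e) (e' # p) h"
      by (auto simp: T.awalk_Cons_iff)
    then show ?case using 3 backtrack by (simp add: T.reduced_def)
  qed (simp_all add: T.reduced_def)
qed

lemma tree_word_eqI:
  assumes A: "A \<subseteq> carrier G - {\<one>}" and sub: "subgraph T (cayley_graph G A)"
    and tree: "undirected_tree T"
    and p: "pre_digraph.awalk T \<one> p g" "pre_digraph.reduced T p"
  shows "tree_word G T g = map snd p"
proof -
  interpret T: simple_tree T using A sub tree by (rule simple_tree_cayley)
  have A': "A \<subseteq> carrier G" using A by blast
  note reduced = reduced_cayley_iff[OF A' sub]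
  have "(THE p. T.awalk \<one> p g \<and> successively (\<lambda>e e'. e' \<noteq> inverse_edge G e) p) = p"
  proof (rule the_equality)
    show "T.awalk \<one> p g \<and> successively (\<lambda>e e'. e' \<noteq> inverse_edge G e) p"
      using p reduced[OF p(1)] by simp
    fix q assume "T.awalk \<one> q g \<and> successively (\<lambda>e e'. e' \<noteq> inverse_edge G e) q"
    then have "T.awalk \<one> q g" "T.reduced q" using reduced by auto
    then show "q = p" using p by (rule T.reduced_unique)
  qed
  then show ?thesis by (simp add: tree_word_def)
qed

end

section \<open>Extending trees and flow functions to a group of finite index\<close>

locale finite_index_extension = group G for G (structure) +
  fixes H A S C :: "'a set"
  assumes subgroup: "subgroup H G"
    and finite_index: "finite (rcosets H)"
    and generating_H: "generating_set (G\<lparr>carrier := H\<rparr>) A"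
    and representatives: "coset_representatives G H S"
    and one_in_S: "\<one> \<in> S"
    and C_def: "C = A \<union> (\<Union>s\<in>S - {\<one>}. {s, inv s})"
begin

sublocale H: subgroup H G by (rule subgroup)

abbreviation K :: "('a, 'b) monoid_scheme" where
  "K \<equiv> G\<lparr>carrier := H\<rparr>"

sublocale K: group K by (rule H.subgroup_is_group) (rule group_axioms)

lemma inv_K: "h \<in> H \<Longrightarrow> inv\<^bsub>K\<^esub> h = inv h"
  using m_inv_consistent[OF subgroup] .

lemma S_closed: "s \<in> S \<Longrightarrow> s \<in> carrier G"
  using representatives by (auto simp: coset_representatives_def)

lemma ex1_representative: "g \<in> carrier G \<Longrightarrow> \<exists>!s. s \<in> S \<and> s \<in> H #> g"
  using representatives rcosetsI[OF H.subset] by (auto simp: coset_representatives_def)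

text \<open>
  Every \<open>g\<close> is uniquely \<open>h \<otimes> s\<close> with \<open>h \<in> H\<close> and \<open>s \<in> S\<close>: \<open>s\<close> is the representative of \<open>g\<close> and
  \<open>h\<close> its subgroup part.
\<close>

definition representative :: "'a \<Rightarrow> 'a" where
  "representative g = (THE s. s \<in> S \<and> s \<in> H #> g)"

definition subgroup_part :: "'a \<Rightarrow> 'a" where
  "subgroup_part g = g \<otimes> inv (representative g)"

lemma representative_eqI:
  assumes "g \<in> carrier G" and "s \<in> S" and "g \<otimes> inv s \<in> H"
  shows "representative g = s"
proof -
  have s: "s \<in> carrier G" using S_closed assms(2) .
  then have "inv (g \<otimes> inv s) \<in> H" using assms(3) by simp
  then have "s \<otimes> inv g \<in> H" using s assms(1) by (simp add: inv_mult_group)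
  then have "s \<in> H #> g" using H.rcos_module_rev[OF group_axioms assms(1) s] by simp
  then show ?thesis
    unfolding representative_def using ex1_representative[OF assms(1)] assms(2) by blast
qed

lemma representative_mult:
  assumes "h \<in> H" and "s \<in> S"
  shows "representative (h \<otimes> s) = s" and "subgroup_part (h \<otimes> s) = h"
proof -
  have "h \<in> carrier G" "s \<in> carrier G" using assms S_closed H.mem_carrier by auto
  then have *: "h \<otimes> s \<otimes> inv s = h" by (simp add: m_assoc)
  then show rep: "representative (h \<otimes> s) = s"
    using representative_eqI[of "h \<otimes> s" s] assms \<open>h \<in> carrier G\<close> \<open>s \<in> carrier G\<close> by simp
  show "subgroup_part (h \<otimes> s) = h" by (simp add: subgroup_part_def rep *)
qed

lemma decomposition:
  assumes "g \<in> carrier G"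
  shows "representative g \<in> S" and "subgroup_part g \<in> H" and "subgroup_part g \<otimes> representative g = g"
proof -
  have rep: "representative g \<in> S" "representative g \<in> H #> g"
    using theI'[OF ex1_representative[OF assms]] by (auto simp: representative_def)
  show "representative g \<in> S" by fact
  have carr: "representative g \<in> carrier G" using rep S_closed by blast
  have "representative g \<otimes> inv g \<in> H"
    using H.rcos_module_imp[OF group_axioms assms rep(2)] .
  then have "inv (representative g \<otimes> inv g) \<in> H" by simp
  then show "subgroup_part g \<in> H"
    using carr assms by (simp add: subgroup_part_def inv_mult_group)
  show "subgroup_part g \<otimes> representative g = g"
    using carr assms by (simp add: subgroup_part_def m_assoc)
qed

lemma representative_in_H: "h \<in> H \<Longrightarrow> representative h = \<one>"
  using representative_mult(1)[OF _ one_in_S] H.mem_carrier by simp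

lemma S_Int_H:
  assumes "s \<in> S" and "s \<in> H"
  shows "s = \<one>"
  using representative_mult(1)[OF H.one_closed assms(1)] representative_in_H[OF assms(2)]
    S_closed[OF assms(1)] by simp

lemma mult_in_H_iff:
  assumes "h \<in> H" and "s \<in> S"
  shows "h \<otimes> s \<in> H \<longleftrightarrow> s = \<one>"
  using representative_mult(1)[OF assms] representative_in_H[of "h \<otimes> s"] assms H.mem_carrier
  by auto

lemma finite_S: "finite S"
proof (rule inj_on_finite[OF _ _ finite_index])
  show "(\<lambda>s. H #> s) ` S \<subseteq> rcosets H" using rcosetsI[OF H.subset] S_closed by auto
  show "inj_on (\<lambda>s. H #> s) S"
  proof (rule inj_onI)
    fix s t assume st: "s \<in> S" "t \<in> S" "H #> s = H #> t"
    then have "s \<in> H #> t" "t \<in> H #> t" using rcos_self[OF S_closed subgroup] by blast+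
    then show "s = t" using ex1_representative[OF S_closed[OF st(2)]] st by blast
  qed
qed

lemma A_subset: "A \<subseteq> H - {\<one>}"
  using generating_H by (simp add: generating_set_def)

lemma A_closed: "A \<subseteq> H" "A \<subseteq> carrier G" "A \<subseteq> carrier G - {\<one>}"
  using A_subset H.subset by auto

lemma A_inv: "\<forall>a\<in>A. inv a \<in> A"
proof
  fix a assume a: "a \<in> A"
  then have "inv\<^bsub>K\<^esub> a \<in> A" using generating_H by (auto simp: generating_set_def)
  then show "inv a \<in> A" using inv_K a A_closed(1) by auto
qed

lemma finite_A: "finite A"
  using generating_H by (simp add: generating_set_def)

lemma generate_A: "generate G A = H"
  using generating_H generate_consistent[OF A_closed(1) subgroup] by (simp add: generating_set_def)

lemma A_subset_C: "A \<subseteq> C" and S_subset_C: "s \<in> S \<Longrightarrow> s \<noteq> \<one> \<Longrightarrow> s \<in> C"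
  and inv_S_subset_C: "s \<in> S \<Longrightarrow> s \<noteq> \<one> \<Longrightarrow> inv s \<in> C"
  by (auto simp: C_def)

lemma C_closed: "C \<subseteq> carrier G - {\<one>}"
  using A_closed(3) S_closed by (auto simp: C_def)

lemma finite_C: "finite C"
  using finite_A finite_S by (auto simp: C_def)

lemma C_inv: "\<forall>c\<in>C. inv c \<in> C"
  using A_inv S_closed by (auto simp: C_def)

lemma generating_C: "generating_set G C"
proof -
  have "g \<in> generate G C" if g: "g \<in> carrier G" for g
  proof -
    have "generate G A \<subseteq> generate G C" using A_subset_C by (rule mono_generate)
    then have "subgroup_part g \<in> generate G C" using decomposition(2)[OF g] generate_A by blast
    moreover have "representative g \<in> generate G C"
      using decomposition(1)[OF g] S_subset_C generate.one generate.incl by metis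
    ultimately show ?thesis using decomposition(3)[OF g] generate.eng by metis
  qed
  moreover have "generate G C \<subseteq> carrier G" using C_closed by (intro generate_incl) auto
  ultimately show ?thesis using finite_C C_closed C_inv by (auto simp: generating_set_def)
qed

text \<open>
  The representative \<open>1\<close> contributes no letter to a normal form.
\<close>

definition letter :: "'a \<Rightarrow> 'a list" where
  "letter g = (if g = \<one> then [] else [g])"

text \<open>
  Choosing the empty word for \<open>1\<close> makes the detours for the new tree edges trivial.
\<close>

definition subgroup_word :: "'a \<Rightarrow> 'a list" where
  "subgroup_word h = (if h = \<one> then [] else SOME w. w \<in> lists A \<and> foldl (\<otimes>) \<one> w = h)"

text \<open>
  The label of the flow path of \<open>e\<^bsub>hs,c\<^esub>\<close>: go down to \<open>h\<close> in \<open>H\<close>, walk inside \<open>H\<close>, and leave \<open>H\<close>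
  along the edge to the end point.  With \<open>sc = h't\<close> the walk inside \<open>H\<close> spells \<open>h'\<close>, so the word
  depends only on the pair \<open>(s, c)\<close>, of which there are finitely many.
\<close>

definition detour :: "'a \<Rightarrow> 'a \<Rightarrow> 'a list" where
  "detour s c = letter (inv s) @ subgroup_word (subgroup_part (s \<otimes> c)) @ letter (representative (s \<otimes> c))"

lemma subgroup_word:
  assumes "h \<in> H"
  shows "subgroup_word h \<in> lists A" and "foldl (\<otimes>) \<one> (subgroup_word h) = h"
proof -
  have "\<exists>w\<in>lists A. foldl (\<otimes>) \<one> w = h"
    using assms generate_imp_word[OF _ A_closed(2) A_inv] generate_A by blast
  then have "\<exists>w. w \<in> lists A \<and> foldl (\<otimes>) \<one> w = h" by blast
  from someI_ex[OF this] show "subgroup_word h \<in> lists A" "foldl (\<otimes>) \<one> (subgroup_word h) = h"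
    unfolding subgroup_word_def by auto
qed

lemma foldl_letter: "g \<in> carrier G \<Longrightarrow> s \<in> carrier G \<Longrightarrow> foldl (\<otimes>) g (letter s) = g \<otimes> s"
  by (simp add: letter_def)

lemma foldl_subgroup_word:
  assumes "g \<in> carrier G" and "h \<in> H"
  shows "foldl (\<otimes>) g (subgroup_word h) = g \<otimes> h"
  using foldl_mult_factor[OF assms(1), of "subgroup_word h"] subgroup_word[OF assms(2)] A_closed(2)
  by auto

lemma letter_S: "s \<in> S \<Longrightarrow> letter s \<in> lists C" "s \<in> S \<Longrightarrow> letter (inv s) \<in> lists C"
  using S_subset_C inv_S_subset_C S_closed by (auto simp: letter_def)

lemma detour_in_lists:
  assumes "s \<in> S" and "c \<in> carrier G"
  shows "detour s c \<in> lists C"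
proof -
  have "s \<otimes> c \<in> carrier G" using assms S_closed by simp
  note d = decomposition[OF this]
  have "subgroup_word (subgroup_part (s \<otimes> c)) \<in> lists C"
    using subgroup_word(1)[OF d(2)] A_subset_C by auto
  then show ?thesis
    using letter_S(1)[OF d(1)] letter_S(2)[OF assms(1)] by (simp add: detour_def)
qed

lemma foldl_detour:
  assumes "g \<in> carrier G" and "c \<in> carrier G"
  shows "foldl (\<otimes>) g (detour (representative g) c) = g \<otimes> c"
proof -
  let ?s = "representative g"
  have carr: "?s \<in> carrier G" "?s \<otimes> c \<in> carrier G"
    using decomposition(1)[OF assms(1)] S_closed assms(2) by auto
  note sc = decomposition[OF carr(2)]
  have "subgroup_part (?s \<otimes> c) \<in> carrier G" "representative (?s \<otimes> c) \<in> carrier G"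
    using sc S_closed H.mem_carrier by auto
  then have "foldl (\<otimes>) g (detour ?s c)
      = g \<otimes> inv ?s \<otimes> (subgroup_part (?s \<otimes> c) \<otimes> representative (?s \<otimes> c))"
    using carr assms sc by (simp add: detour_def foldl_letter foldl_subgroup_word m_assoc)
  also have "\<dots> = g \<otimes> c" using carr assms by (simp add: sc(3) m_assoc inv_solve_left')
  finally show ?thesis .
qed

text \<open>
  For the edges between \<open>h\<close> and \<open>hs\<close> the general formula for a detour already gives the edge itself,
  as required for tree edges.
\<close>

lemma detour_tree_letter:
  assumes "s \<in> S" and "s \<noteq> \<one>"
  shows "detour \<one> s = [s]" and "detour s (inv s) = [inv s]"
proof -
  have s: "s \<in> carrier G" using assms S_closed by blast
  have "representative s = s" "subgroup_part s = \<one>"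
    using representative_mult[OF H.one_closed assms(1)] s by auto
  then show "detour \<one> s = [s]" using assms s by (simp add: detour_def letter_def subgroup_word_def)
  have "representative \<one> = \<one>" "subgroup_part \<one> = \<one>"
    using representative_mult[OF H.one_closed one_in_S] by auto
  moreover have "inv s \<noteq> \<one>" using assms s by simp
  ultimately show "detour s (inv s) = [inv s]" using s by (simp add: detour_def letter_def subgroup_word_def)
qed

definition leaf_arcs :: "('a \<times> 'a) set" where
  "leaf_arcs = {(h, s) | h s. h \<in> H \<and> s \<in> S - {\<one>}} \<union> {(h \<otimes> s, inv s) | h s. h \<in> H \<and> s \<in> S - {\<one>}}"

text \<open>
  A tree in \<open>H\<close>, with the vertex \<open>hs\<close> attached as a leaf at \<open>h\<close> for all \<open>h \<in> H\<close> and
  \<open>s \<in> S\<close>, \<open>s \<noteq> 1\<close>.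
\<close>

definition extended_tree :: "('a, 'a \<times> 'a) pre_digraph \<Rightarrow> ('a, 'a \<times> 'a) pre_digraph" where
  "extended_tree T = \<lparr>verts = carrier G, arcs = arcs T \<union> leaf_arcs,
     tail = fst, head = (\<lambda>(g, a). g \<otimes> a)\<rparr>"

lemma extended_tree_simps:
  "verts (extended_tree T) = carrier G" "arcs (extended_tree T) = arcs T \<union> leaf_arcs"
  "tail (extended_tree T) = fst" "head (extended_tree T) = (\<lambda>(g, a). g \<otimes> a)"
  by (simp_all add: extended_tree_def)

lemma leaf_arcs_cases [consumes 1, case_names to_leaf from_leaf]:
  assumes "e \<in> leaf_arcs"
  obtains h s where "h \<in> H" "s \<in> S" "s \<noteq> \<one>" "e = (h, s)"
  | h s where "h \<in> H" "s \<in> S" "s \<noteq> \<one>" "e = (h \<otimes> s, inv s)"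
  using assms by (auto simp: leaf_arcs_def)

lemma leaf_arcs_subset: "leaf_arcs \<subseteq> carrier G \<times> C"
  using S_subset_C inv_S_subset_C S_closed H.mem_carrier by (auto simp: leaf_arcs_def)

lemma detour_leaf_arc:
  assumes "e \<in> leaf_arcs"
  shows "detour (representative (fst e)) (snd e) = [snd e]" and "e \<notin> H \<times> A"
proof -
  have "detour (representative (fst e)) (snd e) = [snd e] \<and> e \<notin> H \<times> A"
    using assms
  proof (cases e rule: leaf_arcs_cases)
    case (to_leaf h s)
    then show ?thesis using detour_tree_letter representative_in_H S_Int_H A_closed(1) by auto
  next
    case (from_leaf h s)
    then show ?thesis using detour_tree_letter representative_mult(1) mult_in_H_iff by auto
  qed
  then show "detour (representative (fst e)) (snd e) = [snd e]" "e \<notin> H \<times> A" by auto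
qed

end

locale tree_extension = finite_index_extension +
  fixes T :: "('a, 'a \<times> 'a) pre_digraph"
  assumes maximal_T: "maximal_tree (cayley_graph K A) T"
begin

abbreviation T' :: "('a, 'a \<times> 'a) pre_digraph" where
  "T' \<equiv> extended_tree T"

abbreviation \<Gamma>\<^sub>H :: "('a, 'a \<times> 'a) pre_digraph" where
  "\<Gamma>\<^sub>H \<equiv> cayley_graph K A"

abbreviation \<Gamma>\<^sub>G :: "('a, 'a \<times> 'a) pre_digraph" where
  "\<Gamma>\<^sub>G \<equiv> cayley_graph G C"

lemma \<Gamma>\<^sub>H_simps: "verts \<Gamma>\<^sub>H = H" "arcs \<Gamma>\<^sub>H = H \<times> A" "tail \<Gamma>\<^sub>H = fst" "head \<Gamma>\<^sub>H = (\<lambda>(g, a). g \<otimes> a)"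
  by (simp_all add: cayley_graph_simps)

lemma edge_path_K: "edge_path K g w = edge_path G g w"
  by (induction w arbitrary: g) auto

lemma T_sub: "subgraph T \<Gamma>\<^sub>H" and T_tree: "undirected_tree T"
  using maximal_T by (auto simp: maximal_tree_def pre_digraph.max_subgraph_def)

lemma A_subset_K: "A \<subseteq> carrier K - {\<one>\<^bsub>K\<^esub>}" and A_subset_K': "A \<subseteq> carrier K"
  and A_inv_K: "\<forall>a\<in>A. inv\<^bsub>K\<^esub> a \<in> A"
  using A_subset generating_H by (auto simp: generating_set_def)

lemma T_simps: "verts T = H" "tail T = fst" "head T = (\<lambda>(g, a). g \<otimes> a)" and T_arcs: "arcs T \<subseteq> H \<times> A"
proof -
  show "verts T = H"
    using maximal_tree_spanning[OF K.cayley_symmetric[OF A_subset_K' A_inv_K]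
        K.cayley_strongly_connected[OF generating_H] maximal_T] by (simp add: \<Gamma>\<^sub>H_simps)
  show "tail T = fst" "head T = (\<lambda>(g, a). g \<otimes> a)" "arcs T \<subseteq> H \<times> A"
    using T_sub by (auto simp: subgraph_def compatible_def \<Gamma>\<^sub>H_simps)
qed

lemma C_carrier: "C \<subseteq> carrier G"
  using C_closed by blast

lemma \<Gamma>\<^sub>H_sub: "subgraph \<Gamma>\<^sub>H \<Gamma>\<^sub>G"
  unfolding subgraph_def compatible_def
  using cayley_wf[OF C_carrier] K.cayley_wf[OF A_subset_K'] H.subset A_subset_C
  by (auto simp: cayley_graph_simps)

lemma leaf_arc_ends:
  assumes "e \<in> leaf_arcs"
  shows "(fst e \<in> H \<and> fst e \<otimes> snd e \<notin> H \<and> fst e = subgroup_part (fst e \<otimes> snd e)) \<or>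
    (fst e \<otimes> snd e \<in> H \<and> fst e \<notin> H \<and> fst e \<otimes> snd e = subgroup_part (fst e))"
  using assms
proof (cases e rule: leaf_arcs_cases)
  case (to_leaf h s)
  then show ?thesis using mult_in_H_iff[of h s] representative_mult(2)[of h s] by simp
next
  case (from_leaf h s)
  then have "h \<otimes> s \<otimes> inv s = h" using S_closed H.mem_carrier by (simp add: m_assoc)
  then show ?thesis using from_leaf mult_in_H_iff[of h s] representative_mult(2)[of h s] by simp
qed

lemma T'_wf: "wf_digraph T'"
proof
  fix e assume "e \<in> arcs T'"
  then have "e \<in> carrier G \<times> C"
    using T_arcs leaf_arcs_subset H.subset A_subset_C by (auto simp: extended_tree_simps)
  then show "tail T' e \<in> verts T'" "head T' e \<in> verts T'"
    using C_carrier by (auto simp: extended_tree_simps)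
qed

lemma T'_sub: "subgraph T' \<Gamma>\<^sub>G"
  unfolding subgraph_def compatible_def
  using T'_wf cayley_wf[OF C_carrier] T_arcs leaf_arcs_subset H.subset A_subset_C
  by (auto simp: extended_tree_simps cayley_graph_simps)

lemma T_sub_T': "subgraph T T'"
  unfolding subgraph_def compatible_def
  using T'_wf T_sub H.subset by (auto simp: extended_tree_simps T_simps)

lemma T'_symmetric: "symmetric T'"
  unfolding symmetric_conv
proof
  fix e assume "e \<in> arcs T'"
  then consider "e \<in> arcs T" | "e \<in> leaf_arcs" by (auto simp: extended_tree_simps)
  then show "\<exists>e'\<in>arcs T'. tail T' e = head T' e' \<and> head T' e = tail T' e'"
  proof cases
    case 1
    then show ?thesis
      using T_tree by (auto simp: undirected_tree_def symmetric_conv T_simps extended_tree_simps)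
  next
    case 2
    then show ?thesis
    proof (cases e rule: leaf_arcs_cases)
      case (to_leaf h s)
      then have "(h \<otimes> s, inv s) \<in> leaf_arcs" by (auto simp: leaf_arcs_def)
      moreover have "h \<otimes> s \<otimes> inv s = h" using to_leaf S_closed H.mem_carrier by (simp add: m_assoc)
      ultimately show ?thesis
        using to_leaf by (intro bexI[of _ "(h \<otimes> s, inv s)"]) (auto simp: extended_tree_simps)
    next
      case (from_leaf h s)
      then have "(h, s) \<in> leaf_arcs" by (auto simp: leaf_arcs_def)
      moreover have "h \<otimes> s \<otimes> inv s = h" using from_leaf S_closed H.mem_carrier by (simp add: m_assoc)
      ultimately show ?thesis
        using from_leaf by (intro bexI[of _ "(h, s)"]) (auto simp: extended_tree_simps)
    qed
  qed
qed

lemma T'_tree: "undirected_tree T'"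
proof (rule undirected_tree_attach_leaves[OF T_tree T_sub_T' T'_symmetric, where f = subgroup_part])
  fix e assume "e \<in> arcs T' - arcs T"
  then have "e \<in> leaf_arcs" by (auto simp: extended_tree_simps)
  from leaf_arc_ends[OF this]
  show "(tail T' e \<in> verts T \<and> head T' e \<notin> verts T \<and> tail T' e = subgroup_part (head T' e)) \<or>
      (head T' e \<in> verts T \<and> tail T' e \<notin> verts T \<and> head T' e = subgroup_part (tail T' e))"
    by (simp add: extended_tree_simps T_simps case_prod_beta)
next
  fix g assume "g \<in> verts T' - verts T"
  then have g: "g \<in> carrier G" "g \<notin> H" by (auto simp: extended_tree_simps T_simps)
  note d = decomposition[OF g(1)]
  have "representative g \<noteq> \<one>" using d g mult_in_H_iff[OF d(2,1)] by auto
  then have "(g, inv (representative g)) \<in> leaf_arcs" using d unfolding leaf_arcs_def by force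
  then show "\<exists>e\<in>arcs T'. tail T' e = g" by (auto simp: extended_tree_simps intro: bexI[rotated])
qed

lemma maximal_T': "maximal_tree \<Gamma>\<^sub>G T'"
  by (rule spanning_tree_maximal[OF cayley_loopfree[OF C_closed] cayley_nomulti[OF C_carrier] T'_sub T'_tree])
    (simp add: extended_tree_simps cayley_graph_simps)

text \<open>
  The reduced path from \<open>1\<close> to \<open>hs\<close> is the one to \<open>h\<close>, which stays in \<open>H\<close>, followed by one leaf
  edge.
\<close>

lemma tree_word_extended:
  assumes h: "h \<in> H" and s: "s \<in> S"
  shows "tree_word G T' (h \<otimes> s) = tree_word K T h @ letter s" and "tree_word K T h \<in> lists A"
proof -
  interpret T: simple_tree T using K.simple_tree_cayley[OF A_subset_K T_sub T_tree] .
  interpret T': wf_digraph T' by (rule T'_wf)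
  obtain p where p: "T.awalk \<one> p h" "T.reduced p" using T.ex_reduced h T_simps(1) by fastforce
  have word: "tree_word K T h = map snd p"
    using K.tree_word_eqI[OF A_subset_K T_sub T_tree _ p(2)] p(1) by simp
  show "tree_word K T h \<in> lists A"
  proof -
    have "set p \<subseteq> H \<times> A" using p(1) T_arcs unfolding T.awalk_def by blast
    then have "snd e \<in> A" if "e \<in> set p" for e using subsetD[OF _ that, of "H \<times> A"] by auto
    then show ?thesis unfolding word by auto
  qed
  have p': "T'.awalk \<one> p h" using p(1) T'.subgraph_awalk_imp_awalk T_sub_T' by blast
  have red_p: "T'.reduced p" using p(2) by (simp add: T.reduced_def T'.reduced_def T_simps extended_tree_simps)
  show "tree_word G T' (h \<otimes> s) = tree_word K T h @ letter s"
  proof (cases "s = \<one>")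
    case True
    then show ?thesis
      using tree_word_eqI[OF C_closed T'_sub T'_tree p' red_p] word h by (simp add: letter_def H.mem_carrier)
  next
    case False
    then have arc: "(h, s) \<in> arcs T'" using h s by (auto simp: extended_tree_simps leaf_arcs_def)
    then have "T'.awalk h [(h, s)] (h \<otimes> s)"
      using T'.head_in_verts[OF arc] T'.tail_in_verts[OF arc]
      by (simp add: T'.awalk_Cons_iff T'.awalk_Nil_iff extended_tree_simps)
    with p' have walk: "T'.awalk \<one> (p @ [(h, s)]) (h \<otimes> s)" by (rule T'.awalk_appendI)
    have "h \<otimes> s \<notin> H" using mult_in_H_iff[OF h s] False by simp
    moreover have "fst (last p) \<in> H" if "p \<noteq> []"
      using p(1) T_arcs last_in_set[OF that] by (auto simp: T.awalk_def)
    ultimately have "T'.reduced (p @ [(h, s)])"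
      using red_p unfolding T'.reduced_def successively_append_iff by (auto simp: extended_tree_simps)
    from tree_word_eqI[OF C_closed T'_sub T'_tree walk this]
    show ?thesis using word False by (simp add: letter_def)
  qed
qed

end

locale flow_extension = tree_extension +
  fixes \<Phi> :: "'a \<times> 'a \<Rightarrow> ('a \<times> 'a) list"
  assumes flow: "flow_function (cayley_graph K A) T \<Phi>"
    and bounded: "bounded_flow (cayley_graph K A) \<Phi>"
begin

text \<open>
  The given flow is kept on the edges of the Cayley graph of \<open>H\<close>; all other edges are sent along
  their detours.
\<close>

definition \<Phi>' :: "'a \<times> 'a \<Rightarrow> ('a \<times> 'a) list" where
  "\<Phi>' e = (if e \<in> H \<times> A then \<Phi> e else edge_path G (fst e) (detour (representative (fst e)) (snd e)))"

lemma flow_walk: "e \<in> H \<times> A \<Longrightarrow> pre_digraph.awalk \<Gamma>\<^sub>H (tail \<Gamma>\<^sub>H e) (\<Phi> e) (head \<Gamma>\<^sub>H e)"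
  using flow unfolding flow_function_def \<Gamma>\<^sub>H_simps(2) by blast

text \<open>
  The arcs of a detour outside the tree are those of the middle part, which stays in \<open>H\<close>; this is
  why the extended flow relation remains well-founded.
\<close>

lemma detour_arcs:
  assumes g: "g \<in> carrier G" and c: "c \<in> carrier G"
  shows "set (edge_path G g (detour (representative g) c)) \<subseteq> arcs T' \<union> H \<times> A"
proof -
  let ?s = "representative g"
  note d = decomposition[OF g]
  define h where "h = subgroup_part g"
  have h: "h \<in> H" "h \<in> carrier G" using d(2) H.mem_carrier by (auto simp: h_def)
  have s: "?s \<in> S" "?s \<in> carrier G" using d(1) S_closed by auto
  have g_eq: "g = h \<otimes> ?s" using d(3) by (simp add: h_def)
  have sc: "?s \<otimes> c \<in> carrier G" using s c by simp
  note d' = decomposition[OF sc]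
  let ?k = "subgroup_part (?s \<otimes> c)" and ?t = "representative (?s \<otimes> c)"
  have to_H: "foldl (\<otimes>) g (letter (inv ?s)) = h"
    using g s h by (subst foldl_letter) (simp_all add: h_def subgroup_part_def)
  have in_H: "foldl (\<otimes>) h (subgroup_word ?k) = h \<otimes> ?k"
    using foldl_subgroup_word[OF h(2) d'(2)] .
  have "edge_path G g (detour ?s c) = edge_path G g (letter (inv ?s))
      @ edge_path G h (subgroup_word ?k) @ edge_path G (h \<otimes> ?k) (letter ?t)"
    by (simp add: detour_def edge_path_append to_H in_H)
  moreover have "set (edge_path G g (letter (inv ?s))) \<subseteq> arcs T'"
  proof (cases "?s = \<one>")
    case False
    then have "(g, inv ?s) \<in> leaf_arcs" unfolding leaf_arcs_def using g_eq h s by force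
    then show ?thesis by (auto simp: letter_def extended_tree_simps)
  qed (simp add: letter_def)
  moreover have "set (edge_path G h (subgroup_word ?k)) \<subseteq> H \<times> A"
    using K.awalk_edge_path[OF A_subset_K', of h "subgroup_word ?k"] h subgroup_word(1)[OF d'(2)]
    by (simp add: pre_digraph.awalk_def \<Gamma>\<^sub>H_simps edge_path_K)
  moreover have "set (edge_path G (h \<otimes> ?k) (letter ?t)) \<subseteq> arcs T'"
  proof (cases "?t = \<one>")
    case False
    then have "(h \<otimes> ?k, ?t) \<in> leaf_arcs" unfolding leaf_arcs_def using h d' by force
    then show ?thesis by (auto simp: letter_def extended_tree_simps)
  qed (simp add: letter_def)
  ultimately show ?thesis by auto
qed

text \<open>
  A detour passes, apart from tree edges, only through edges of the Cayley graph of \<open>H\<close>, and the flow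
  path of an edge of \<open>H\<close> stays in \<open>H\<close>.  So the new flow relation adds to the given one only pairs
  that descend from outside \<open>H\<close> into \<open>H\<close>, and these can occur at most once in a descending chain.
\<close>

lemma flow_extended: "flow_function \<Gamma>\<^sub>G T' \<Phi>'"
  unfolding flow_function_def
proof (intro conjI ballI impI)
  interpret \<Gamma>\<^sub>G: wf_digraph \<Gamma>\<^sub>G by (rule cayley_wf[OF C_carrier])
  show "\<Gamma>\<^sub>G.awalk (tail \<Gamma>\<^sub>G e) (\<Phi>' e) (head \<Gamma>\<^sub>G e)" if e: "e \<in> arcs \<Gamma>\<^sub>G" for e
  proof (cases "e \<in> H \<times> A")
    case True
    from \<Gamma>\<^sub>G.subgraph_awalk_imp_awalk[OF flow_walk[OF this] \<Gamma>\<^sub>H_sub]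
    show ?thesis using True by (simp add: \<Phi>'_def cayley_graph_simps)
  next
    case False
    obtain g c where gc: "e = (g, c)" "g \<in> carrier G" "c \<in> C" "c \<in> carrier G"
      using e C_carrier by (auto simp: cayley_graph_simps)
    then show ?thesis
      using awalk_edge_path[OF C_carrier gc(2) detour_in_lists[OF decomposition(1)[OF gc(2)] gc(4)]]
        foldl_detour[OF gc(2,4)] False by (auto simp: \<Phi>'_def cayley_graph_simps)
  qed
  show "\<Phi>' e = [e]" if "e \<in> arcs \<Gamma>\<^sub>G" and e: "e \<in> arcs T'" for e
  proof (cases "e \<in> arcs T")
    case True
    then show ?thesis using flow T_arcs by (auto simp: flow_function_def \<Gamma>\<^sub>H_simps \<Phi>'_def)
  next
    case False
    then have leaf: "e \<in> leaf_arcs" using e by (simp add: extended_tree_simps)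
    show ?thesis using detour_leaf_arc[OF leaf] by (simp add: \<Phi>'_def)
  qed
  \<comment> \<open>The pairs in \<open>?D\<close> lead from outside \<open>H\<close> into \<open>H\<close>, and nothing leads back.\<close>
  let ?R = "flow_relation \<Gamma>\<^sub>H T \<Phi>" and ?D = "(H \<times> A) \<times> - (H \<times> A)"
  have "flow_relation \<Gamma>\<^sub>G T' \<Phi>' \<subseteq> ?R \<union> ?D"
  proof (rule subrelI)
    fix e' e assume "(e', e) \<in> flow_relation \<Gamma>\<^sub>G T' \<Phi>'"
    then have e: "e \<in> arcs \<Gamma>\<^sub>G" "e \<notin> arcs T'" "e' \<notin> arcs T'" "e' \<in> set (\<Phi>' e)"
      by (auto simp: flow_relation_def)
    show "(e', e) \<in> ?R \<union> ?D"
    proof (cases "e \<in> H \<times> A")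
      case True
      then have "e' \<in> H \<times> A" using flow_walk[OF True] e(4) by (auto simp: pre_digraph.awalk_def \<Gamma>\<^sub>H_simps \<Phi>'_def)
      then have "(e', e) \<in> ?R"
        using e True by (simp add: flow_relation_def \<Gamma>\<^sub>H_simps \<Phi>'_def extended_tree_simps)
      then show ?thesis ..
    next
      case False
      have "fst e \<in> carrier G" "snd e \<in> carrier G"
        using e(1) C_carrier by (auto simp: cayley_graph_simps)
      from detour_arcs[OF this] have "e' \<in> H \<times> A" using e(3,4) False by (auto simp: \<Phi>'_def)
      then show ?thesis using False by blast
    qed
  qed
  moreover have "wf (?R \<union> ?D)"
  proof (rule wf_Un)
    have "wf (?R\<^sup>+)" using flow by (simp add: flow_function_def)
    then show "wf ?R" by (rule wf_subset) (rule subrelI, rule r_into_trancl)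
    show "wf ?D" by (rule wf_subset[OF wf_measure[of "\<lambda>e. if e \<in> H \<times> A then 0 else 1"]])
        (auto split: if_splits)
    show "Domain ?R \<inter> Range ?D = {}" by (auto simp: flow_relation_def \<Gamma>\<^sub>H_simps)
  qed
  ultimately show "wf ((flow_relation \<Gamma>\<^sub>G T' \<Phi>')\<^sup>+)" by (intro wf_trancl) (rule wf_subset)
qed

lemma bounded_extended: "bounded_flow \<Gamma>\<^sub>G \<Phi>'"
proof -
  obtain k where k: "\<forall>e\<in>H \<times> A. length (\<Phi> e) \<le> k"
    using bounded by (auto simp: bounded_flow_def \<Gamma>\<^sub>H_simps)
  let ?lengths = "(\<lambda>(s, c). length (detour s c)) ` (S \<times> C)"
  have fin: "finite ?lengths" using finite_S finite_C by simp
  have "length (\<Phi>' e) \<le> max k (Max ?lengths)" if e: "e \<in> arcs \<Gamma>\<^sub>G" for e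
  proof (cases "e \<in> H \<times> A")
    case True
    then show ?thesis using k by (auto simp: \<Phi>'_def le_max_iff_disj)
  next
    case False
    have "(representative (fst e), snd e) \<in> S \<times> C"
      using e decomposition(1) by (auto simp: cayley_graph_simps)
    then have "length (detour (representative (fst e)) (snd e)) \<in> ?lengths" by force
    then show ?thesis
      unfolding \<Phi>'_def using False Max_ge[OF fin] by (simp add: length_edge_path le_max_iff_disj del: Max_ge)
  qed
  then show ?thesis unfolding bounded_flow_def by blast
qed

text \<open>
  Only finitely many words of a fixed form are combined with the normal forms of \<open>H\<close>; this is what
  carries regularity and decidability from \<open>H\<close> to \<open>G\<close>.
\<close>

lemma stacking_graph_extended:
  "stacking_graph G C T' \<Phi>' = stacking_graph K A T \<Phi> \<union>
    (\<Union>(s, c)\<in>S \<times> C - {\<one>} \<times> A. (\<lambda>y. [y @ letter s, [c], detour s c]) ` tree_word K T ` H)"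
    (is "?L = ?M \<union> ?N")
proof (intro subset_antisym subsetI)
  fix us assume "us \<in> ?L"
  then obtain g c where gc: "g \<in> carrier G" "c \<in> C"
    and us: "us = [tree_word G T' g, [c], map snd (\<Phi>' (g, c))]"
    by (auto simp: stacking_graph_def)
  define h s where "h = subgroup_part g" and "s = representative g"
  have hs: "h \<in> H" "s \<in> S" "g = h \<otimes> s" using decomposition[OF gc(1)] by (auto simp: h_def s_def)
  have y: "tree_word G T' g = tree_word K T h @ letter s" using tree_word_extended(1)[OF hs(1,2)] hs(3) by simp
  have g_H: "g \<in> H \<longleftrightarrow> s = \<one>" using mult_in_H_iff[OF hs(1,2)] hs(3) by simp
  show "us \<in> ?M \<union> ?N"
  proof (cases "s = \<one> \<and> c \<in> A")
    case True
    then have "g = h" "g \<in> H" using hs g_H H.mem_carrier by auto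
    then have "us = [tree_word K T h, [c], map snd (\<Phi> (h, c))]"
      using us y True by (simp add: \<Phi>'_def letter_def)
    then have "us \<in> ?M" using hs(1) True by (auto simp: stacking_graph_def)
    then show ?thesis ..
  next
    case False
    then have "us = [tree_word K T h @ letter s, [c], detour s c]"
      using us y g_H by (auto simp: \<Phi>'_def map_snd_edge_path s_def)
    moreover have "(s, c) \<in> S \<times> C - {\<one>} \<times> A" using False hs gc by auto
    ultimately have "us \<in> ?N" using hs(1) by blast
    then show ?thesis ..
  qed
next
  fix us assume "us \<in> ?M \<union> ?N"
  then consider h a where "h \<in> H" "a \<in> A" "us = [tree_word K T h, [a], map snd (\<Phi> (h, a))]"
    | s c h where "s \<in> S" "c \<in> C" "\<not> (s = \<one> \<and> c \<in> A)" "h \<in> H"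
      "us = [tree_word K T h @ letter s, [c], detour s c]"
    by (fastforce simp: stacking_graph_def)
  then show "us \<in> ?L"
  proof cases
    case 1
    then have "tree_word G T' h = tree_word K T h"
      using tree_word_extended(1)[OF 1(1) one_in_S] H.mem_carrier by (simp add: letter_def)
    then have "us = [tree_word G T' h, [a], map snd (\<Phi>' (h, a))]" using 1 by (simp add: \<Phi>'_def)
    moreover have "h \<in> carrier G" "a \<in> C" using 1 A_subset_C H.mem_carrier by auto
    ultimately show ?thesis unfolding stacking_graph_def by blast
  next
    case 2
    then have "h \<otimes> s \<in> carrier G" using S_closed H.mem_carrier by simp
    moreover have "(h \<otimes> s, c) \<notin> H \<times> A" using 2 mult_in_H_iff by auto
    then have "us = [tree_word G T' (h \<otimes> s), [c], map snd (\<Phi>' (h \<otimes> s, c))]"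
      using 2 tree_word_extended(1) representative_mult(1) by (auto simp: \<Phi>'_def map_snd_edge_path)
    ultimately show ?thesis unfolding stacking_graph_def using 2(2) by blast
  qed
qed

end

section \<open>Closure properties of regular languages\<close>

text \<open>
  Regularity is handled in the form of Myhill and Nerode: a language is regular iff it has finitely
  many residuals.  This makes the closure properties short, since for each of them it suffices to
  exhibit finitely many data about a word \<open>u\<close> that determine its residual.
\<close>

definition residual :: "'a list \<Rightarrow> 'a list set \<Rightarrow> 'a list set" where
  "residual u L = {v. u @ v \<in> L}"

lemma regular_imp_finite_residuals:
  assumes "regular_language \<Sigma> L"
  shows "finite ((\<lambda>u. residual u L) ` lists \<Sigma>)" and "L \<subseteq> lists \<Sigma>"
proof -
  obtain Q :: "nat set" and q0 F \<delta> where Q: "finite Q" "q0 \<in> Q"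
    and \<delta>: "\<forall>q\<in>Q. \<forall>x\<in>\<Sigma>. \<delta> q x \<in> Q" and L: "L = {w \<in> lists \<Sigma>. foldl \<delta> q0 w \<in> F}"
    using assms unfolding regular_language_def by blast
  show "L \<subseteq> lists \<Sigma>" using L by blast
  have in_Q: "foldl \<delta> q0 u \<in> Q" if "u \<in> lists \<Sigma>" for u
    using that by (induction u rule: rev_induct) (use Q \<delta> in auto)
  have "residual u L = {v \<in> lists \<Sigma>. foldl \<delta> (foldl \<delta> q0 u) v \<in> F}" if "u \<in> lists \<Sigma>" for u
    using that by (auto simp: residual_def L)
  then have "(\<lambda>u. residual u L) ` lists \<Sigma> \<subseteq> (\<lambda>q. {v \<in> lists \<Sigma>. foldl \<delta> q v \<in> F}) ` Q"
    using in_Q by blast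
  then show "finite ((\<lambda>u. residual u L) ` lists \<Sigma>)"
    by (rule finite_surj[OF Q(1)])
qed

text \<open>
  The residuals themselves are the states of an automaton.  They are numbered by \<open>e\<close> because states
  have to be natural numbers.
\<close>

lemma finite_residuals_imp_regular:
  assumes L: "L \<subseteq> lists \<Sigma>" and fin: "finite ((\<lambda>u. residual u L) ` lists \<Sigma>)"
  shows "regular_language \<Sigma> L"
proof -
  define D where "D = (\<lambda>u. residual u L) ` lists \<Sigma>"
  obtain e :: "'a list set \<Rightarrow> nat" where e: "inj_on e D"
    using finite_imp_inj_to_nat_seg[OF fin[folded D_def]] by blast
  define \<delta> where "\<delta> q x = e (residual [x] (the_inv_into D e q))" for q x
  have step: "\<delta> (e (residual u L)) x = e (residual (u @ [x]) L)" if "u \<in> lists \<Sigma>" for u x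
  proof -
    have "residual u L \<in> D" using that by (auto simp: D_def)
    then have "the_inv_into D e (e (residual u L)) = residual u L"
      using e by (simp add: the_inv_into_f_f)
    then show ?thesis by (simp add: \<delta>_def residual_def)
  qed
  have run: "foldl \<delta> (e (residual [] L)) u = e (residual u L)" if "u \<in> lists \<Sigma>" for u
    using that by (induction u rule: rev_induct) (auto simp: step)
  define F where "F = e ` {K \<in> D. [] \<in> K}"
  have accept: "e (residual u L) \<in> F \<longleftrightarrow> u \<in> L" if "u \<in> lists \<Sigma>" for u
  proof -
    have "residual u L \<in> D" using that by (auto simp: D_def)
    then have "e (residual u L) \<in> F \<longleftrightarrow> [] \<in> residual u L"
      using e by (auto simp: F_def inj_on_def)
    then show ?thesis by (simp add: residual_def)
  qed
  show ?thesis
    unfolding regular_language_def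
  proof (intro exI conjI ballI)
    show "finite (e ` D)" using fin by (simp add: D_def)
    show "e (residual [] L) \<in> e ` D" by (auto simp: D_def)
    show "F \<subseteq> e ` D" by (auto simp: F_def)
    show "\<delta> q x \<in> e ` D" if "q \<in> e ` D" "x \<in> \<Sigma>" for q x
    proof -
      obtain u where "u \<in> lists \<Sigma>" "q = e (residual u L)" using \<open>q \<in> e ` D\<close> by (auto simp: D_def)
      then have "\<delta> q x = e (residual (u @ [x]) L)" "u @ [x] \<in> lists \<Sigma>"
        using step that by auto
      then show ?thesis by (auto simp: D_def)
    qed
    show "L = {w \<in> lists \<Sigma>. foldl \<delta> (e (residual [] L)) w \<in> F}"
    proof (intro Set.set_eqI iffI)
      fix w assume "w \<in> L"
      then have "w \<in> lists \<Sigma>" using L by blast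
      then show "w \<in> {w \<in> lists \<Sigma>. foldl \<delta> (e (residual [] L)) w \<in> F}"
        using run accept \<open>w \<in> L\<close> by simp
    next
      fix w assume "w \<in> {w \<in> lists \<Sigma>. foldl \<delta> (e (residual [] L)) w \<in> F}"
      then show "w \<in> L" using run[of w] accept[of w] by simp
    qed
  qed
qed

text \<open>
  The form in which finiteness of residuals is used: an invariant \<open>R\<close> with finitely many values
  that determines the residual.
\<close>

lemma regular_by_finite_invariant:
  assumes L: "L \<subseteq> lists \<Sigma>" and fin: "finite (R ` lists \<Sigma>)"
    and R: "\<And>u u' v. u \<in> lists \<Sigma> \<Longrightarrow> u' \<in> lists \<Sigma> \<Longrightarrow> R u = R u' \<Longrightarrow> u @ v \<in> L \<Longrightarrow> u' @ v \<in> L"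
  shows "regular_language \<Sigma> L"
proof (rule finite_residuals_imp_regular[OF L])
  have "residual u L = residual (inv_into (lists \<Sigma>) R (R u)) L" if u: "u \<in> lists \<Sigma>" for u
  proof -
    have *: "inv_into (lists \<Sigma>) R (R u) \<in> lists \<Sigma>" "R (inv_into (lists \<Sigma>) R (R u)) = R u"
      by (rule inv_into_into[OF imageI[OF u]] f_inv_into_f[OF imageI[OF u]])+
    show ?thesis
      unfolding residual_def
      using R[OF u *(1) *(2)[symmetric]] R[OF *(1) u *(2)] by blast
  qed
  then have "(\<lambda>u. residual u L) ` lists \<Sigma>
      \<subseteq> (\<lambda>r. residual (inv_into (lists \<Sigma>) R r) L) ` (R ` lists \<Sigma>)" by blast
  then show "finite ((\<lambda>u. residual u L) ` lists \<Sigma>)" by (rule finite_surj[OF fin])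
qed

text \<open>
  Short words may be remembered literally.
\<close>

lemma finite_invariant_except_short:
  assumes "finite \<Sigma>" and "finite (f ` lists \<Sigma>)"
  shows "finite ((\<lambda>u. if length u \<le> n then Inl u else Inr (f u)) ` lists \<Sigma>)"
proof (rule finite_subset)
  show "(\<lambda>u. if length u \<le> n then Inl u else Inr (f u)) ` lists \<Sigma>
      \<subseteq> Inl ` {u. set u \<subseteq> \<Sigma> \<and> length u \<le> n} \<union> Inr ` (f ` lists \<Sigma>)"
    by (auto split: if_splits)
  show "finite (Inl ` {u. set u \<subseteq> \<Sigma> \<and> length u \<le> n} \<union> Inr ` (f ` lists \<Sigma>))"
    using finite_lists_length_le[OF assms(1), of n] assms(2) by simp
qed

lemma regular_empty: "regular_language \<Sigma> {}"
  by (rule regular_by_finite_invariant[where R = "\<lambda>_. ()"]) auto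

lemma regular_empty_word: "regular_language \<Sigma> {[]}"
  by (rule regular_by_finite_invariant[where R = "\<lambda>u. u = []"]) auto

lemma regular_union:
  assumes "regular_language \<Sigma> L" and "regular_language \<Sigma> M"
  shows "regular_language \<Sigma> (L \<union> M)"
proof (rule regular_by_finite_invariant)
  let ?R = "\<lambda>u. (residual u L, residual u M)"
  show "L \<union> M \<subseteq> lists \<Sigma>" using assms regular_imp_finite_residuals(2) by blast
  have "?R ` lists \<Sigma> \<subseteq> (\<lambda>u. residual u L) ` lists \<Sigma> \<times> (\<lambda>u. residual u M) ` lists \<Sigma>" by auto
  then show "finite (?R ` lists \<Sigma>)"
    by (rule finite_subset) (use assms[THEN regular_imp_finite_residuals(1)] in simp)
qed (auto simp: residual_def)

lemma regular_larger_alphabet: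
  assumes reg: "regular_language \<Sigma> L" and sub: "\<Sigma> \<subseteq> \<Sigma>'"
  shows "regular_language \<Sigma>' L"
proof (rule finite_residuals_imp_regular)
  note L = regular_imp_finite_residuals[OF reg]
  show "L \<subseteq> lists \<Sigma>'" using L(2) sub by blast
  have "residual u L = {}" if "u \<notin> lists \<Sigma>" for u
    using that L(2) by (auto simp: residual_def)
  then have "(\<lambda>u. residual u L) ` lists \<Sigma>' \<subseteq> insert {} ((\<lambda>u. residual u L) ` lists \<Sigma>)" by blast
  then show "finite ((\<lambda>u. residual u L) ` lists \<Sigma>')" by (rule finite_subset) (use L(1) in simp)
qed

lemma regular_append_letter:
  assumes reg: "regular_language \<Sigma> L" and a: "a \<in> \<Sigma>"
  shows "regular_language \<Sigma> ((\<lambda>u. u @ [a]) ` L)" (is "regular_language \<Sigma> ?M")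
proof (rule regular_by_finite_invariant)
  note L = regular_imp_finite_residuals[OF reg]
  \<comment> \<open>The second component takes care of the empty continuation, where \<open>a\<close> is the last letter of \<open>u\<close>.\<close>
  let ?R = "\<lambda>u. (residual u L, u \<in> ?M)"
  show "?M \<subseteq> lists \<Sigma>"
  proof
    fix w assume "w \<in> ?M"
    then obtain u where "w = u @ [a]" "u \<in> lists \<Sigma>" using L(2) by blast
    then show "w \<in> lists \<Sigma>" using a by simp
  qed
  have "?R ` lists \<Sigma> \<subseteq> (\<lambda>u. residual u L) ` lists \<Sigma> \<times> UNIV" by auto
  then show "finite (?R ` lists \<Sigma>)" by (rule finite_subset) (use L(1) in simp)
  fix u u' v assume R: "?R u = ?R u'" and uv: "u @ v \<in> ?M"
  show "u' @ v \<in> ?M"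
  proof (cases v rule: rev_cases)
    case Nil
    then show ?thesis using R uv by simp
  next
    case (snoc v' b)
    then have "b = a" "v' \<in> residual u L" using uv by (auto simp: residual_def)
    then have "u' @ v' \<in> L" using R by (auto simp: residual_def)
    then show ?thesis using snoc \<open>b = a\<close> by force
  qed
qed

lemma length_padded_word: "length (padded_word us) = Max (length ` set us)"
  by (simp add: padded_word_def)

lemma inj_padded_word:
  assumes len: "length us = length vs" and eq: "padded_word us = padded_word vs"
  shows "us = vs"
proof (rule nth_equalityI[OF len])
  let ?M = "Max (length ` set us)"
  have M: "?M = Max (length ` set vs)" using eq length_padded_word by metis
  fix j assume j: "j < length us"
  have le: "length (us ! j) \<le> ?M" "length (vs ! j) \<le> ?M"
    using j len by (auto simp: M) (auto simp flip: M)
  have cell: "(if m < length (us ! j) then Some (us ! j ! m) else None)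
      = (if m < length (vs ! j) then Some (vs ! j ! m) else None)" if "m < ?M" for m
  proof -
    have "padded_word us ! m ! j = padded_word vs ! m ! j" using eq by simp
    then show ?thesis using that j len M by (simp add: padded_word_def cong: if_cong)
  qed
  have lens: "length (us ! j) = length (vs ! j)"
    using cell[of "length (us ! j)"] cell[of "length (vs ! j)"] le
    by (cases "length (us ! j)" "length (vs ! j)" rule: linorder_cases) auto
  show "us ! j = vs ! j"
  proof (rule nth_equalityI[OF lens])
    fix m assume "m < length (us ! j)"
    then show "us ! j ! m = vs ! j ! m" using cell[of m] le lens by simp
  qed
qed

text \<open>
  Once \<open>u\<close> is at least as long as the other components, these contribute only padding, and
  synchronous reading continues letter by letter in the first component.
\<close>

lemma padded_word_append_first:
  assumes "\<forall>w\<in>set ws. length w \<le> length u"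
  shows "padded_word ((u @ v) # ws)
    = padded_word (u # ws) @ map (\<lambda>a. Some a # replicate (length ws) None) v"
proof -
  have M: "Max (length ` set ((u @ v) # ws)) = length u + length v"
    "Max (length ` set (u # ws)) = length u"
    using assms by (auto intro!: Max_eqI)
  have ws: "map (\<lambda>w. if m < length w then Some (w ! m) else None) ws = replicate (length ws) None"
    if "m \<ge> length u" for m
    using assms that by (intro replicate_eqI) auto
  show ?thesis
    unfolding padded_word_def M
    by (rule nth_equalityI) (auto simp: nth_append ws cong: if_cong)
qed

lemma padded_word_in_lists:
  assumes "us \<in> word_tuples A n" and "n > 0"
  shows "padded_word us \<in> lists (padded_alphabet A n)"
proof -
  let ?col = "\<lambda>m. map (\<lambda>u. if m < length u then Some (u ! m) else None) us"
  have len: "length us = n" and us: "\<And>u. u \<in> set us \<Longrightarrow> set u \<subseteq> A"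
    using assms by (auto simp: word_tuples_def)
  have "?col m \<in> padded_alphabet A n" if "m < Max (length ` set us)" for m
  proof -
    have "Max (length ` set us) \<in> length ` set us"
      using len \<open>n > 0\<close> by (intro Max_in) auto
    then obtain u where "u \<in> set us" "Max (length ` set us) = length u" by (rule imageE)
    then have "u \<in> set us" "m < length u" using that by auto
    then have "Some (u ! m) \<in> set (?col m)" by force
    then have "?col m \<noteq> replicate n None" by (metis in_set_replicate option.distinct(1))
    moreover have "set (?col m) \<subseteq> insert None (Some ` A)"
    proof
      fix x assume "x \<in> set (?col m)"
      then obtain u where "u \<in> set us" "x = (if m < length u then Some (u ! m) else None)" by auto
      then show "x \<in> insert None (Some ` A)"
        using subsetD[OF us nth_mem, of u m] by (cases "m < length u") auto
    qed
    ultimately show ?thesis using len by (simp add: padded_alphabet_def)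
  qed
  then show ?thesis by (auto simp: padded_word_def)
qed

lemma finite_padded_alphabet: "finite A \<Longrightarrow> finite (padded_alphabet A n)"
  unfolding padded_alphabet_def
  by (rule finite_subset[OF _ finite_lists_length_eq[of "insert None (Some ` A)" n]]) auto

lemma synchronously_regular_larger_alphabet:
  assumes "synchronously_regular A n L" and "A \<subseteq> C"
  shows "synchronously_regular C n L"
proof -
  have "padded_alphabet A n \<subseteq> padded_alphabet C n"
    using \<open>A \<subseteq> C\<close> by (fastforce simp: padded_alphabet_def)
  moreover have "word_tuples A n \<subseteq> word_tuples C n"
    using \<open>A \<subseteq> C\<close> by (auto simp: word_tuples_def)
  ultimately show ?thesis
    using assms regular_larger_alphabet unfolding synchronously_regular_def by blast
qed

lemma synchronously_regular_union:
  assumes "synchronously_regular A n L" and "synchronously_regular A n M"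
  shows "synchronously_regular A n (L \<union> M)"
  using assms regular_union by (auto simp: synchronously_regular_def image_Un)

text \<open>
  A word \<open>u\<close> longer than all fixed components acts on its continuations like the padded tuple
  \<open>u # ws\<close>; shorter words are remembered.
\<close>

lemma regular_section:
  assumes L: "synchronously_regular A (Suc n) L" and "finite A" and ws: "ws \<in> word_tuples A n"
  shows "regular_language A {u. u # ws \<in> L}"
proof (rule regular_by_finite_invariant)
  let ?P = "padded_word ` L" and ?\<Sigma> = "padded_alphabet A (Suc n)"
  define b where "b = Max (insert 0 (length ` set ws))"
  have b: "\<forall>w\<in>set ws. length w \<le> length u" if "length u > b" for u :: "'a list"
  proof
    fix w assume "w \<in> set ws"
    then have "length w \<le> b" unfolding b_def by (intro Max_ge) auto
    then show "length w \<le> length u" using that by simp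
  qed
  let ?f = "\<lambda>u. residual (padded_word (u # ws)) ?P"
  let ?R = "\<lambda>u. if length u \<le> b then Inl u else Inr (?f u)"
  show "{u. u # ws \<in> L} \<subseteq> lists A"
  proof
    fix u assume "u \<in> {u. u # ws \<in> L}"
    then have "u # ws \<in> word_tuples A (Suc n)" using L by (auto simp: synchronously_regular_def)
    then show "u \<in> lists A" by (simp add: word_tuples_def)
  qed
  have "padded_word (u # ws) \<in> lists ?\<Sigma>" if "u \<in> lists A" for u
    using that ws by (intro padded_word_in_lists) (auto simp: word_tuples_def)
  then have "?f ` lists A \<subseteq> (\<lambda>p. residual p ?P) ` lists ?\<Sigma>"
    by (intro image_subsetI imageI)
  moreover have "finite \<dots>"
    using L regular_imp_finite_residuals(1) by (auto simp: synchronously_regular_def)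
  ultimately have "finite (?f ` lists A)" by (rule finite_subset)
  then show "finite (?R ` lists A)" by (rule finite_invariant_except_short[OF \<open>finite A\<close>])
  fix u u' v assume R: "?R u = ?R u'" and uv: "u @ v \<in> {u. u # ws \<in> L}"
  show "u' @ v \<in> {u. u # ws \<in> L}"
  proof (cases "length u \<le> b")
    case True
    then show ?thesis using R uv by (auto split: if_splits)
  next
    case False
    then have long: "length u > b" "length u' > b" and f: "?f u = ?f u'"
      using R by (auto split: if_splits)
    let ?q = "map (\<lambda>a. Some a # replicate (length ws) None) v"
    have "padded_word ((u @ v) # ws) \<in> ?P" using uv by simp
    then have "?q \<in> ?f u" by (simp add: residual_def padded_word_append_first[OF b[OF long(1)]])
    then have "?q \<in> ?f u'" by (simp only: f)
    then have "padded_word ((u' @ v) # ws) \<in> ?P"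
      by (simp add: residual_def padded_word_append_first[OF b[OF long(2)]])
    then obtain us where us: "padded_word ((u' @ v) # ws) = padded_word us" "us \<in> L"
      by (rule imageE)
    have "length us = length ((u' @ v) # ws)"
      using us(2) L ws by (auto simp: synchronously_regular_def word_tuples_def)
    then have "us = (u' @ v) # ws" using us(1)[symmetric] by (rule inj_padded_word)
    then show ?thesis using us(2) by simp
  qed
qed

text \<open>
  A prefix longer than the fixed components \<open>ws\<close> is either not the start of any padded tuple
  \<open>u # ws\<close>, or it is itself one of these, for a unique \<open>u\<close>, and then the residual of \<open>u\<close> decides about
  the continuations.  Both cases are expressed by a union over all such \<open>u\<close>.
\<close>

lemma synchronously_regular_cylinder:
  assumes N: "regular_language A N" and "finite A" and ws: "ws \<in> word_tuples A n"
  shows "synchronously_regular A (Suc n) ((\<lambda>u. u # ws) ` N)"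
proof -
  note res = regular_imp_finite_residuals[OF N]
  let ?\<Sigma> = "padded_alphabet A (Suc n)" and ?pad = "\<lambda>u. padded_word (u # ws)"
  have tuple: "u # ws \<in> word_tuples A (Suc n)" if "u \<in> lists A" for u
    using that ws by (auto simp: word_tuples_def)
  define b where "b = Max (insert 0 (length ` set ws))"
  have b: "\<forall>w\<in>set ws. length w \<le> b" unfolding b_def by (auto intro!: Max_ge)
  let ?f = "\<lambda>p. \<Union>u\<in>{u \<in> lists A. ?pad u = p}. residual u N"
  let ?R = "\<lambda>p. if length p \<le> b then Inl p else Inr (?f p)"
  have "regular_language ?\<Sigma> (?pad ` N)"
  proof (rule regular_by_finite_invariant)
    show "?pad ` N \<subseteq> lists ?\<Sigma>"
      using res(2) by (intro image_subsetI padded_word_in_lists tuple) auto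
    have "?f p \<in> insert {} ((\<lambda>u. residual u N) ` lists A)" for p
    proof (cases "\<exists>u\<in>lists A. ?pad u = p")
      case True
      then obtain u where u: "u \<in> lists A" "?pad u = p" by blast
      have "u' = u" if "?pad u' = p" for u'
        using inj_padded_word[of "u' # ws" "u # ws"] that u by simp
      then have "{u \<in> lists A. ?pad u = p} = {u}" using u by blast
      then show ?thesis using u by simp
    qed auto
    then have "?f ` lists ?\<Sigma> \<subseteq> insert {} ((\<lambda>u. residual u N) ` lists A)" by (rule image_subsetI)
    then have "finite (?f ` lists ?\<Sigma>)" by (rule finite_subset) (use res(1) in simp)
    then show "finite (?R ` lists ?\<Sigma>)"
      by (rule finite_invariant_except_short[OF finite_padded_alphabet[OF \<open>finite A\<close>]])
    fix p p' q assume R: "?R p = ?R p'" and pq: "p @ q \<in> ?pad ` N"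
    show "p' @ q \<in> ?pad ` N"
    proof (cases "length p \<le> b")
      case True
      then show ?thesis using R pq by (auto split: if_splits)
    next
      case False
      then have long: "length p > b" "length p' > b" and f: "?f p = ?f p'"
        using R by (auto split: if_splits)
      obtain x where x: "x \<in> N" "p @ q = ?pad x" using pq by blast
      have len_pad: "length (?pad u) = length u" if "length (?pad u) > b" for u
      proof -
        have "Max (length ` set (u # ws)) \<in> length ` set (u # ws)" by (rule Max_in) auto
        then show ?thesis using that b by (auto simp: length_padded_word)
      qed
      define u v where "u = take (length p) x" and "v = drop (length p) x"
      have "length x = length p + length q"
        using len_pad[of x] x(2) long by (metis length_append trans_less_add1)
      then have uv: "x = u @ v" "length u = length p" by (auto simp: u_def v_def)
      let ?q = "map (\<lambda>a. Some a # replicate (length ws) None) v"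
      have "\<forall>w\<in>set ws. length w \<le> length u" using b long uv by fastforce
      then have "p @ q = ?pad u @ ?q" using x uv padded_word_append_first by metis
      moreover have "length (?pad u) = length p"
        using uv b long by (auto simp: length_padded_word intro!: Max_eqI)
      ultimately have p: "p = ?pad u" and q: "q = ?q" by auto
      have "u \<in> lists A" using x(1) uv(1) res(2) by auto
      then have "v \<in> ?f p" using p x(1) uv(1) by (auto simp: residual_def)
      then obtain u' where u': "?pad u' = p'" "u' @ v \<in> N"
        using f by (auto simp: residual_def)
      then have "\<forall>w\<in>set ws. length w \<le> length u'"
        using len_pad[of u'] long b by fastforce
      then have "?pad (u' @ v) = p' @ q" using u' q padded_word_append_first by metis
      then show ?thesis using u' by (metis image_eqI)
    qed
  qed
  moreover have "(\<lambda>u. u # ws) ` N \<subseteq> word_tuples A (Suc n)"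
    using res(2) by (intro image_subsetI tuple) auto
  ultimately show ?thesis by (simp add: synchronously_regular_def image_image)
qed

section \<open>Closure properties of decidable languages\<close>

lemma recursive_comp1:
  assumes "recursive_fn 1 f" and "recursive_fn n g"
  shows "recursive_fn n (\<lambda>xs. f [g xs])"
  using recursive_fn.comp[of "[g]" f n] assms by simp

lemma recursive_comp2:
  assumes "recursive_fn 2 f" and "recursive_fn n g" and "recursive_fn n h"
  shows "recursive_fn n (\<lambda>xs. f [g xs, h xs])"
  using recursive_fn.comp[of "[g, h]" f n] assms by (simp add: numeral_2_eq_2)

lemma recursive_comp3:
  assumes "recursive_fn 3 f" and "recursive_fn n g" and "recursive_fn n h" and "recursive_fn n k"
  shows "recursive_fn n (\<lambda>xs. f [g xs, h xs, k xs])"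
  using recursive_fn.comp[of "[g, h, k]" f n] assms by (simp add: numeral_3_eq_3)

lemma recursive_Suc: "recursive_fn n f \<Longrightarrow> recursive_fn n (\<lambda>xs. Suc (f xs))"
  using recursive_comp1[OF recursive_fn.succ, of n f] by simp

lemma recursive_const: "recursive_fn n (\<lambda>xs. c)"
  by (induction c) (rule recursive_fn.zero, rule recursive_Suc)

lemma recursive_binary:
  assumes "recursive_fn 2 h" and "\<And>a b. h [a, b] = g a b"
    and "recursive_fn n f1" and "recursive_fn n f2"
  shows "recursive_fn n (\<lambda>xs. g (f1 xs) (f2 xs))"
  using recursive_comp2[OF assms(1,3,4)] assms(2) by simp

lemma recursive_add:
  assumes "recursive_fn n f" and "recursive_fn n g"
  shows "recursive_fn n (\<lambda>xs. f xs + g xs)"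
proof (rule recursive_binary[OF _ _ assms])
  show "recursive_fn 2 (\<lambda>xs. rec_nat (tl xs ! 0) (\<lambda>k r. Suc ((k # r # tl xs) ! 1)) (hd xs))"
    using recursive_fn.prim_rec[of 1 "\<lambda>xs. xs ! 0" "\<lambda>xs. Suc (xs ! 1)"]
    by (simp add: recursive_fn.proj recursive_Suc numeral_2_eq_2)
  show "rec_nat (tl [a, b] ! 0) (\<lambda>k r. Suc ((k # r # tl [a, b]) ! 1)) (hd [a, b]) = a + b" for a b :: nat
    by (induction a) auto
qed

lemma recursive_pred:
  assumes "recursive_fn n f"
  shows "recursive_fn n (\<lambda>xs. f xs - 1)"
proof -
  have "recursive_fn 1 (\<lambda>xs. rec_nat 0 (\<lambda>k r. (k # r # tl xs) ! 0) (hd xs))"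
    using recursive_fn.prim_rec[of 0 "\<lambda>xs. 0" "\<lambda>xs. xs ! 0"]
    by (simp add: recursive_fn.proj recursive_fn.zero)
  from recursive_comp1[OF this assms] show ?thesis
  proof (rule recursive_fn.restrict, intro allI impI)
    fix xs
    show "f xs - 1 = rec_nat 0 (\<lambda>k r. (k # r # tl [f xs]) ! 0) (hd [f xs])"
      by (cases "f xs") auto
  qed
qed

lemma recursive_diff:
  assumes "recursive_fn n f" and "recursive_fn n g"
  shows "recursive_fn n (\<lambda>xs. f xs - g xs)"
proof (rule recursive_binary[where g = "\<lambda>b a. a - b", OF _ _ assms(2,1)])
  show "recursive_fn 2 (\<lambda>xs. rec_nat (tl xs ! 0) (\<lambda>k r. (k # r # tl xs) ! 1 - 1) (hd xs))"
    using recursive_fn.prim_rec[of 1 "\<lambda>xs. xs ! 0" "\<lambda>xs. xs ! 1 - 1"]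
    by (simp add: recursive_fn.proj recursive_pred[unfolded One_nat_def] numeral_2_eq_2)
  show "rec_nat (tl [b, a] ! 0) (\<lambda>k r. (k # r # tl [b, a]) ! 1 - 1) (hd [b, a]) = a - b" for a b :: nat
    by (induction b) auto
qed

lemma recursive_if_zero:
  assumes "recursive_fn n c" and "recursive_fn n f" and "recursive_fn n g"
  shows "recursive_fn n (\<lambda>xs. if c xs = 0 then f xs else g xs)"
proof -
  have "recursive_fn 3 (\<lambda>xs. rec_nat (tl xs ! 0) (\<lambda>k r. (k # r # tl xs) ! 3) (hd xs))"
    using recursive_fn.prim_rec[of 2 "\<lambda>xs. xs ! 0" "\<lambda>xs. xs ! 3"]
    by (simp add: recursive_fn.proj)
  from recursive_comp3[OF this assms] show ?thesis
  proof (rule recursive_fn.restrict, intro allI impI)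
    fix xs
    show "(if c xs = 0 then f xs else g xs)
        = rec_nat (tl [c xs, f xs, g xs] ! 0) (\<lambda>k r. (k # r # tl [c xs, f xs, g xs]) ! 3) (hd [c xs, f xs, g xs])"
      by (cases "c xs") auto
  qed
qed

definition recursive_set :: "nat \<Rightarrow> (nat list \<Rightarrow> bool) \<Rightarrow> bool" where
  "recursive_set n P \<longleftrightarrow> recursive_fn n (\<lambda>xs. if P xs then 1 else 0)"

lemma recursive_if:
  assumes "recursive_set n P" and "recursive_fn n f" and "recursive_fn n g"
  shows "recursive_fn n (\<lambda>xs. if P xs then f xs else g xs)"
  using recursive_if_zero[OF assms(1)[unfolded recursive_set_def] assms(3,2)]
  by (rule recursive_fn.restrict) auto

lemma recursive_set_const: "recursive_set n (\<lambda>xs. b)"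
  unfolding recursive_set_def by (rule recursive_const)

lemma recursive_set_conj:
  assumes "recursive_set n P" and "recursive_set n Q"
  shows "recursive_set n (\<lambda>xs. P xs \<and> Q xs)"
  unfolding recursive_set_def
  using recursive_if[OF assms(1) assms(2)[unfolded recursive_set_def] recursive_const[of n 0]]
  by (rule recursive_fn.restrict) auto

lemma recursive_set_disj:
  assumes "recursive_set n P" and "recursive_set n Q"
  shows "recursive_set n (\<lambda>xs. P xs \<or> Q xs)"
  unfolding recursive_set_def
  using recursive_if[OF assms(1) recursive_const[of n 1] assms(2)[unfolded recursive_set_def]]
  by (rule recursive_fn.restrict) auto

lemma recursive_set_eq:
  assumes "recursive_fn n f" and "recursive_fn n g"
  shows "recursive_set n (\<lambda>xs. f xs = g xs)"
  unfolding recursive_set_def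
  using recursive_if_zero[OF recursive_add[OF recursive_diff[OF assms] recursive_diff[OF assms(2,1)]]
      recursive_const[of n 1] recursive_const[of n 0]]
  by (rule recursive_fn.restrict) auto

lemma recursive_set_less:
  assumes "recursive_fn n f" and "recursive_fn n g"
  shows "recursive_set n (\<lambda>xs. f xs < g xs)"
  unfolding recursive_set_def
  using recursive_if_zero[OF recursive_diff[OF recursive_Suc[OF assms(1)] assms(2)]
      recursive_const[of n 1] recursive_const[of n 0]]
  by (rule recursive_fn.restrict) auto

lemma recursive_triangle:
  assumes "recursive_fn n f"
  shows "recursive_fn n (\<lambda>xs. triangle (f xs))"
proof -
  have "recursive_fn 1 (\<lambda>xs. rec_nat 0 (\<lambda>k r. (k # r # tl xs) ! 1 + Suc ((k # r # tl xs) ! 0)) (hd xs))"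
    using recursive_fn.prim_rec[of 0 "\<lambda>xs. 0" "\<lambda>xs. xs ! 1 + Suc (xs ! 0)"]
    by (simp add: recursive_fn.proj recursive_fn.zero recursive_add recursive_Suc)
  moreover have "rec_nat 0 (\<lambda>k r. (k # r # tl xs) ! 1 + Suc ((k # r # tl xs) ! 0)) m = triangle m"
    for m and xs :: "nat list"
    by (induction m) (auto simp: triangle_Suc)
  ultimately show ?thesis
    using recursive_comp1 assms by fastforce
qed

lemma recursive_Cons_code:
  assumes "recursive_fn n f" and "recursive_fn n g"
  shows "recursive_fn n (\<lambda>xs. Suc (prod_encode (f xs, g xs)))"
  unfolding prod_encode_def prod.case
  by (intro recursive_Suc recursive_add recursive_triangle assms)

lemma triangle_mono: "i \<le> j \<Longrightarrow> triangle i \<le> triangle j"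
  unfolding triangle_def by (intro div_le_mono mult_le_mono) auto

lemma Least_triangle:
  "(LEAST k. Suc m - triangle (Suc k) = 0) = fst (prod_decode m) + snd (prod_decode m)"
proof -
  obtain a b where ab: "prod_decode m = (a, b)" by fastforce
  have m: "m = triangle (a + b) + a"
    using prod_decode_inverse[of m] unfolding ab prod_encode_def by simp
  show ?thesis
    unfolding ab fst_conv snd_conv
  proof (rule Least_equality)
    show "Suc m - triangle (Suc (a + b)) = 0" by (simp add: m triangle_Suc)
    fix k assume k: "Suc m - triangle (Suc k) = 0"
    show "a + b \<le> k"
    proof (rule ccontr)
      assume "\<not> a + b \<le> k"
      then have "triangle (Suc k) \<le> triangle (a + b)" by (intro triangle_mono) simp
      then show False using k m by simp
    qed
  qed
qed

text \<open>
  A number \<open>m\<close> codes the pair \<open>(a, b)\<close> iff \<open>m = triangle (a + b) + a\<close> and \<open>a + b\<close> is the least \<open>k\<close>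
  with \<open>m < triangle (k + 1)\<close>; so a single minimisation, which always succeeds, inverts the pairing.
\<close>

lemma recursive_prod_decode:
  assumes "recursive_fn n f"
  shows "recursive_fn n (\<lambda>xs. fst (prod_decode (f xs)))"
    and "recursive_fn n (\<lambda>xs. snd (prod_decode (f xs)))"
proof -
  have "recursive_fn (Suc 1) (\<lambda>xs. Suc (xs ! 1) - triangle (Suc (xs ! 0)))"
    by (intro recursive_diff recursive_Suc recursive_triangle recursive_fn.proj) auto
  moreover have "\<forall>xs :: nat list. length xs = 1 \<longrightarrow>
      (\<exists>k. Suc ((k # xs) ! 1) - triangle (Suc ((k # xs) ! 0)) = 0)"
  proof (intro allI impI)
    fix xs :: "nat list" 
    have "Suc ((xs ! 0 # xs) ! 1) - triangle (Suc ((xs ! 0 # xs) ! 0)) = 0"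
      by (simp add: triangle_Suc)
    then show "\<exists>k. Suc ((k # xs) ! 1) - triangle (Suc ((k # xs) ! 0)) = 0" ..
  qed
  ultimately have "recursive_fn 1 (\<lambda>xs. LEAST k. Suc ((k # xs) ! 1) - triangle (Suc ((k # xs) ! 0)) = 0)"
    by (rule recursive_fn.minimise)
  from recursive_comp1[OF this assms]
  have sum: "recursive_fn n (\<lambda>xs. fst (prod_decode (f xs)) + snd (prod_decode (f xs)))"
    by (rule recursive_fn.restrict) (simp add: Least_triangle[symmetric])
  have eq: "m - triangle (fst (prod_decode m) + snd (prod_decode m)) = fst (prod_decode m)" for m
    using prod_decode_inverse[of m] by (cases "prod_decode m") (auto simp: prod_encode_def)
  show fst: "recursive_fn n (\<lambda>xs. fst (prod_decode (f xs)))"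
    using recursive_diff[OF assms recursive_triangle[OF sum]] by (simp add: eq)
  show "recursive_fn n (\<lambda>xs. snd (prod_decode (f xs)))"
    using recursive_diff[OF sum fst] by simp
qed

definition head_code :: "nat \<Rightarrow> nat" where
  "head_code x = fst (prod_decode (x - 1))"

definition tail_code :: "nat \<Rightarrow> nat" where
  "tail_code x = (if x = 0 then 0 else snd (prod_decode (x - 1)))"

lemma head_code_Cons: "head_code (list_encode (x # xs)) = x"
  by (simp add: head_code_def)

lemma tail_code_eq: "tail_code (list_encode xs) = list_encode (tl xs)"
  by (cases xs) (auto simp: tail_code_def)

lemma recursive_head_code: "recursive_fn n f \<Longrightarrow> recursive_fn n (\<lambda>xs. head_code (f xs))"
  unfolding head_code_def by (intro recursive_prod_decode recursive_pred)

lemma recursive_tail_code: "recursive_fn n f \<Longrightarrow> recursive_fn n (\<lambda>xs. tail_code (f xs))"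
  unfolding tail_code_def
  by (intro recursive_if_zero recursive_prod_decode recursive_pred recursive_const)

lemma length_le_list_encode: "length xs \<le> list_encode xs"
proof (induction xs)
  case (Cons x xs)
  then show ?case using le_prod_encode_2[of "list_encode xs" x] by simp
qed simp

text \<open>
  The loop is a primitive recursion whose \<open>k\<close>-th step reads the head of the code of the list without
  its first \<open>k\<close> entries and does nothing once the list is exhausted.  The code of a list is a bound
  for its length and can therefore serve as the number of steps.
\<close>

lemma recursive_foldl:
  assumes g: "recursive_fn 2 (\<lambda>xs. g (xs ! 0) (xs ! 1))" and f: "recursive_fn n f"
  shows "recursive_fn n (\<lambda>xs. foldl g r (list_decode (f xs)))"
proof -
  have "recursive_fn 2 (\<lambda>xs. rec_nat (tl xs ! 0) (\<lambda>k r. tail_code ((k # r # tl xs) ! 1)) (hd xs))"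
    using recursive_fn.prim_rec[of 1 "\<lambda>xs. xs ! 0" "\<lambda>xs. tail_code (xs ! 1)"]
    by (simp add: recursive_fn.proj recursive_tail_code numeral_2_eq_2)
  moreover have "rec_nat (list_encode ys) (\<lambda>k r. tail_code r) k = list_encode (drop k ys)" for k ys
    by (induction k) (auto simp: tail_code_eq drop_Suc tl_drop)
  from this[of "list_decode x" for x]
  have "rec_nat x (\<lambda>k r. tail_code r) k = list_encode (drop k (list_decode x))" for k x
    by simp
  ultimately have "recursive_fn 2 (\<lambda>xs. list_encode (drop (hd xs) (list_decode (tl xs ! 0))))"
    by simp
  from recursive_comp2[OF this]
  have drop: "recursive_fn m (\<lambda>xs. list_encode (drop (h1 xs) (list_decode (h2 xs))))"
    if "recursive_fn m h1" "recursive_fn m h2" for m h1 h2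
    using that by fastforce
  \<comment> \<open>In \<open>?step\<close>, the number \<open>x\<close> codes the whole list and \<open>r\<close> is the value of the fold after \<open>k\<close> entries.\<close>
  let ?drop = "\<lambda>k x. list_encode (drop k (list_decode x))"
  let ?step = "\<lambda>k r x. if ?drop k x = 0 then r else g r (head_code (?drop k x))"
  have remaining: "recursive_fn (1 + 2) (\<lambda>xs. ?drop (xs ! 0) (xs ! 2))"
    by (intro drop recursive_fn.proj) auto
  have accumulator: "recursive_fn (1 + 2) (\<lambda>xs. xs ! 1)" by (rule recursive_fn.proj) simp
  have "recursive_fn (1 + 2) (\<lambda>xs. g (xs ! 1) (head_code (?drop (xs ! 0) (xs ! 2))))"
    using recursive_comp2[OF g accumulator recursive_head_code[OF remaining]] by simp
  then have "recursive_fn (1 + 2) (\<lambda>xs. ?step (xs ! 0) (xs ! 1) (xs ! 2))"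
    by (rule recursive_if_zero[OF remaining accumulator])
  from recursive_fn.prim_rec[OF recursive_const[of 1 r] this]
  have rec: "recursive_fn 2
      (\<lambda>xs. rec_nat r (\<lambda>k r. ?step ((k # r # tl xs) ! 0) ((k # r # tl xs) ! 1) ((k # r # tl xs) ! 2)) (hd xs))"
    by (simp only: numeral_2_eq_2 One_nat_def)
  have step: "?step k (foldl g r (take k (list_decode x))) x = foldl g r (take (Suc k) (list_decode x))" for k x
  proof (cases "k < length (list_decode x)")
    case True
    then have "drop k (list_decode x) = list_decode x ! k # drop (Suc k) (list_decode x)"
      by (simp add: Cons_nth_drop_Suc)
    then show ?thesis using True
      by (simp add: take_Suc_conv_app_nth head_code_Cons del: list_encode.simps) simp
  qed simp
  have "rec_nat r (\<lambda>k r. ?step k r x) k = foldl g r (take k (list_decode x))" for k x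
    by (induction k) (simp_all only: step nat.rec, simp)
  moreover have "take x (list_decode x) = list_decode x" for x
    using length_le_list_encode[of "list_decode x"] by simp
  ultimately show ?thesis
    using recursive_comp2[OF rec f f] by (simp cong: if_cong)
qed

lemma recursive_set_all_less:
  assumes "recursive_fn n f"
  shows "recursive_set n (\<lambda>xs. \<forall>v\<in>set (list_decode (f xs)). v < k)"
proof -
  let ?g = "\<lambda>r v. if v < k then r else 0 :: nat"
  have "foldl ?g 0 vs = 0" for vs by (induction vs) auto
  then have "foldl ?g 1 vs = (if \<forall>v\<in>set vs. v < k then 1 else 0)" for vs
    by (induction vs) auto
  moreover have "recursive_fn 2 (\<lambda>xs. ?g (xs ! 0) (xs ! 1))"
    by (intro recursive_if recursive_set_less recursive_fn.proj recursive_const) auto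
  ultimately show ?thesis
    using recursive_foldl[of ?g n f 1] assms by (simp add: recursive_set_def)
qed

lemma recursive_rev_code:
  assumes "recursive_fn n f"
  shows "recursive_fn n (\<lambda>xs. list_encode (rev (list_decode (f xs))))"
proof -
  let ?g = "\<lambda>r v. Suc (prod_encode (v, r))"
  have "foldl ?g 0 vs = list_encode (rev vs)" for vs
    by (induction vs rule: rev_induct) auto
  moreover have "recursive_fn 2 (\<lambda>xs. ?g (xs ! 0) (xs ! 1))"
    by (intro recursive_Cons_code recursive_fn.proj) auto
  ultimately show ?thesis
    using recursive_foldl[of ?g n f 0] assms by simp
qed

text \<open>
  The code of a list gives access to its front only, so the list is reversed twice.
\<close>

lemma recursive_butlast_code:
  assumes "recursive_fn n f"
  shows "recursive_fn n (\<lambda>xs. list_encode (butlast (list_decode (f xs))))"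
proof -
  have "butlast vs = rev (tl (rev vs))" for vs :: "nat list"
    by (metis butlast_rev rev_rev_ident)
  then show ?thesis
    using recursive_rev_code[OF recursive_tail_code[OF recursive_rev_code[OF assms]]]
    by (simp add: tail_code_eq)
qed

definition word_code :: "('a \<Rightarrow> nat) \<Rightarrow> 'a list \<Rightarrow> nat" where
  "word_code c u = list_encode (map c u)"

text \<open>
  Decidability with a fixed numbering of the letters: sets that are to be combined have to be decided
  with respect to the same one.
\<close>

definition decidable_under :: "('a \<Rightarrow> nat) \<Rightarrow> 'a set \<Rightarrow> nat \<Rightarrow> 'a list list set \<Rightarrow> bool" where
  "decidable_under c A n L \<longleftrightarrow> L \<subseteq> word_tuples A n \<and>
     (\<exists>P. recursive_set n P \<and> (\<forall>us\<in>word_tuples A n. P (map (word_code c) us) \<longleftrightarrow> us \<in> L))"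

lemma decidable_words_iff:
  "decidable_words A n L \<longleftrightarrow> (\<exists>c. inj_on c A \<and> decidable_under c A n L)"
proof
  assume "decidable_words A n L"
  then obtain c f where c: "inj_on c A" and f: "recursive_fn n f" and L: "L \<subseteq> word_tuples A n"
    and dec: "\<forall>us\<in>word_tuples A n. f (map (\<lambda>u. list_encode (map c u)) us) = (if us \<in> L then 1 else 0)"
    unfolding decidable_words_def by blast
  have "recursive_set n (\<lambda>xs. f xs = 1)" by (rule recursive_set_eq[OF f recursive_const])
  moreover have "\<forall>us\<in>word_tuples A n. f (map (word_code c) us) = 1 \<longleftrightarrow> us \<in> L"
    using dec by (simp add: word_code_def[abs_def])
  ultimately have "decidable_under c A n L" using L by (auto simp: decidable_under_def)
  then show "\<exists>c. inj_on c A \<and> decidable_under c A n L" using c by blast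
next
  assume "\<exists>c. inj_on c A \<and> decidable_under c A n L"
  then obtain c P where c: "inj_on c A" and P: "recursive_set n P" and L: "L \<subseteq> word_tuples A n"
    and dec: "\<forall>us\<in>word_tuples A n. P (map (word_code c) us) \<longleftrightarrow> us \<in> L"
    unfolding decidable_under_def by blast
  show "decidable_words A n L"
    unfolding decidable_words_def
  proof (intro conjI exI)
    show "\<forall>us\<in>word_tuples A n. (\<lambda>xs. if P xs then 1 else 0) (map (\<lambda>u. list_encode (map c u)) us)
        = (if us \<in> L then 1 else 0)"
      using dec by (simp add: word_code_def[abs_def])
  qed (use c P L in \<open>simp_all add: recursive_set_def\<close>)
qed

lemma decidable_underI:
  assumes "recursive_set n P" and "L \<subseteq> word_tuples A n"
    and "\<And>us. us \<in> word_tuples A n \<Longrightarrow> P (map (word_code c) us) \<longleftrightarrow> us \<in> L"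
  shows "decidable_under c A n L"
  using assms unfolding decidable_under_def by blast

lemma decidable_under_union:
  assumes "decidable_under c A n L" and "decidable_under c A n M"
  shows "decidable_under c A n (L \<union> M)"
proof -
  obtain P Q where "recursive_set n P" "recursive_set n Q"
    and "\<forall>us\<in>word_tuples A n. P (map (word_code c) us) \<longleftrightarrow> us \<in> L"
    and "\<forall>us\<in>word_tuples A n. Q (map (word_code c) us) \<longleftrightarrow> us \<in> M"
    using assms by (auto simp: decidable_under_def)
  then show ?thesis
    using assms by (intro decidable_underI[OF recursive_set_disj[of n P Q]]) (auto simp: decidable_under_def)
qed

lemma word_code_eq_iff:
  assumes "inj_on c A" and "u \<in> lists A" and "v \<in> lists A"
  shows "word_code c u = word_code c v \<longleftrightarrow> u = v"
  using inj_on_map_eq_map[of c u v] assms inj_on_subset[of c A "set u \<union> set v"]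
  by (auto simp: word_code_def lists_eq_set list_encode_eq)

lemma decidable_section:
  assumes L: "decidable_under c A 3 L" and w: "w \<in> lists A" and w': "w' \<in> lists A"
  shows "decidable_under c A 1 ((\<lambda>u. [u]) ` {u. [u, w, w'] \<in> L})"
proof -
  obtain P where P: "recursive_set 3 P" and L_sub: "L \<subseteq> word_tuples A 3"
    and dec: "\<And>us. us \<in> word_tuples A 3 \<Longrightarrow> P (map (word_code c) us) \<longleftrightarrow> us \<in> L"
    using L by (auto simp: decidable_under_def)
  show ?thesis
  proof (rule decidable_underI)
    show "recursive_set 1 (\<lambda>xs. P [xs ! 0, word_code c w, word_code c w'])"
      unfolding recursive_set_def
      by (rule recursive_comp3[OF P[unfolded recursive_set_def]])
        (auto intro: recursive_fn.proj recursive_const)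
    show "(\<lambda>u. [u]) ` {u. [u, w, w'] \<in> L} \<subseteq> word_tuples A 1"
    proof (rule image_subsetI)
      fix u assume "u \<in> {u. [u, w, w'] \<in> L}"
      then have "[u, w, w'] \<in> word_tuples A 3" using L_sub by auto
      then show "[u] \<in> word_tuples A 1" by (simp add: word_tuples_def)
    qed
    fix us assume "us \<in> word_tuples A 1"
    then obtain u where us: "us = [u]" "u \<in> lists A"
      by (auto simp: word_tuples_def length_Suc_conv)
    then have "[u, w, w'] \<in> word_tuples A 3" using w w' by (simp add: word_tuples_def)
    from dec[OF this] show "P [map (word_code c) us ! 0, word_code c w, word_code c w']
        \<longleftrightarrow> us \<in> (\<lambda>u. [u]) ` {u. [u, w, w'] \<in> L}"
      using us by auto
  qed
qed

lemma decidable_cylinder: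
  assumes c: "inj_on c A" and N: "decidable_under c A 1 ((\<lambda>u. [u]) ` N)"
    and w: "w \<in> lists A" and w': "w' \<in> lists A"
  shows "decidable_under c A 3 ((\<lambda>u. [u, w, w']) ` N)"
proof -
  obtain P where P: "recursive_set 1 P" and N_sub: "(\<lambda>u. [u]) ` N \<subseteq> word_tuples A 1"
    and dec: "\<And>us. us \<in> word_tuples A 1 \<Longrightarrow> P (map (word_code c) us) \<longleftrightarrow> us \<in> (\<lambda>u. [u]) ` N"
    using N by (auto simp: decidable_under_def)
  show ?thesis
  proof (rule decidable_underI)
    have "recursive_set 3 (\<lambda>xs. P [xs ! 0])"
      unfolding recursive_set_def
      by (rule recursive_comp1[OF P[unfolded recursive_set_def]]) (auto intro: recursive_fn.proj)
    then show "recursive_set 3 (\<lambda>xs. P [xs ! 0] \<and> xs ! 1 = word_code c w \<and> xs ! 2 = word_code c w')"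
      by (intro recursive_set_conj recursive_set_eq recursive_fn.proj recursive_const) auto
    show "(\<lambda>u. [u, w, w']) ` N \<subseteq> word_tuples A 3"
    proof (rule image_subsetI)
      fix u assume "u \<in> N"
      then have "[u] \<in> word_tuples A 1" using N_sub by auto
      then show "[u, w, w'] \<in> word_tuples A 3" using w w' by (simp add: word_tuples_def)
    qed
    fix us assume "us \<in> word_tuples A 3"
    then obtain u v v' where us: "us = [u, v, v']" and lists: "u \<in> lists A" "v \<in> lists A" "v' \<in> lists A"
      by (auto simp: word_tuples_def length_Suc_conv numeral_3_eq_3)
    have "P [word_code c u] \<longleftrightarrow> u \<in> N"
      using dec[of "[u]"] lists by (auto simp: word_tuples_def)
    then show "P [map (word_code c) us ! 0] \<and> map (word_code c) us ! 1 = word_code c w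
        \<and> map (word_code c) us ! 2 = word_code c w' \<longleftrightarrow> us \<in> (\<lambda>u. [u, w, w']) ` N"
      using lists w w' by (auto simp: us word_code_eq_iff[OF c])
  qed
qed

lemma decidable_append_letter:
  assumes c: "inj_on c A" and N: "decidable_under c A 1 ((\<lambda>u. [u]) ` N)" and a: "a \<in> A"
  shows "decidable_under c A 1 ((\<lambda>u. [u]) ` (\<lambda>u. u @ [a]) ` N)"
proof -
  obtain P where P: "recursive_set 1 P" and N_sub: "(\<lambda>u. [u]) ` N \<subseteq> word_tuples A 1"
    and dec: "\<And>us. us \<in> word_tuples A 1 \<Longrightarrow> P (map (word_code c) us) \<longleftrightarrow> us \<in> (\<lambda>u. [u]) ` N"
    using N by (auto simp: decidable_under_def)
  let ?butlast = "\<lambda>x. list_encode (butlast (list_decode x))"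
  let ?rev = "\<lambda>x. list_encode (rev (list_decode x))"
  show ?thesis
  proof (rule decidable_underI)
    have "recursive_set 1 (\<lambda>xs. P [?butlast (xs ! 0)])"
      unfolding recursive_set_def
      by (rule recursive_comp1[OF P[unfolded recursive_set_def]])
        (auto intro: recursive_fn.proj recursive_butlast_code)
    then show "recursive_set 1
        (\<lambda>xs. 0 < xs ! 0 \<and> head_code (?rev (xs ! 0)) = c a \<and> P [?butlast (xs ! 0)])"
      by (intro recursive_set_conj recursive_set_eq recursive_set_less recursive_head_code
          recursive_rev_code recursive_fn.proj recursive_const) auto
    have "[u @ [a]] \<in> word_tuples A 1" if "u \<in> N" for u
    proof -
      have "[u] \<in> word_tuples A 1" using N_sub that by auto
      then show ?thesis using a by (simp add: word_tuples_def)
    qed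
    then show "(\<lambda>u. [u]) ` (\<lambda>u. u @ [a]) ` N \<subseteq> word_tuples A 1" by auto
    fix us assume "us \<in> word_tuples A 1"
    then obtain u where us: "us = [u]" and u: "u \<in> lists A"
      by (auto simp: word_tuples_def length_Suc_conv)
    show "0 < map (word_code c) us ! 0 \<and> head_code (?rev (map (word_code c) us ! 0)) = c a
        \<and> P [?butlast (map (word_code c) us ! 0)] \<longleftrightarrow> us \<in> (\<lambda>u. [u]) ` (\<lambda>u. u @ [a]) ` N"
    proof (cases u rule: rev_cases)
      case Nil
      then show ?thesis by (auto simp: us word_code_def)
    next
      case (snoc v b)
      \<comment> \<open>Only the empty word has code 0, so the first test excludes it.\<close>
      have nonzero: "0 < word_code c u"
        using length_le_list_encode[of "map c u"] snoc by (simp add: word_code_def)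
      have head: "head_code (?rev (word_code c u)) = c b"
        using snoc head_code_Cons[of "c b" "map c (rev v)"] by (simp add: word_code_def rev_map)
      have butlast: "?butlast (word_code c u) = word_code c v"
        using snoc by (simp add: word_code_def map_butlast[symmetric])
      have "P [word_code c v] \<longleftrightarrow> v \<in> N"
        using dec[of "[v]"] u snoc by (auto simp: word_tuples_def)
      moreover have "c b = c a \<longleftrightarrow> b = a"
        using c a u snoc by (auto simp: inj_on_def)
      ultimately show ?thesis
        using nonzero by (auto simp: us head butlast snoc[symmetric]) (auto simp: snoc)
    qed
  qed
qed

lemma decidable_empty: "decidable_under c A n {}"
  by (rule decidable_underI[OF recursive_set_const[of n False]]) auto

lemma decidable_empty_word: "decidable_under c A 1 ((\<lambda>u. [u]) ` {[]})"
proof (rule decidable_underI)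
  show "recursive_set 1 (\<lambda>xs. xs ! 0 = 0)"
    by (intro recursive_set_eq recursive_fn.proj recursive_const) auto
  fix us assume "us \<in> word_tuples A 1"
  then obtain u where us: "us = [u]" by (auto simp: word_tuples_def length_Suc_conv)
  have "word_code c u = 0 \<longleftrightarrow> u = []"
    using length_le_list_encode[of "map c u"] by (auto simp: word_code_def)
  then show "map (word_code c) us ! 0 = 0 \<longleftrightarrow> us \<in> (\<lambda>u. [u]) ` {[]}" by (auto simp: us)
qed (auto simp: word_tuples_def)

text \<open>
  If the letters of \<open>A\<close> receive the numbers below \<open>k\<close>, as expressed by the last assumption, then it can
  be tested whether a word over \<open>C\<close> is a word over \<open>A\<close>, where the given decision procedure applies.
\<close>

lemma decidable_larger_alphabet:
  assumes L: "decidable_under c A 3 L" and A: "A \<subseteq> C"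
    and c': "\<And>a. a \<in> A \<Longrightarrow> c' a = c a"
    and k: "\<And>a. a \<in> C \<Longrightarrow> c' a < k \<longleftrightarrow> a \<in> A"
  shows "decidable_under c' C 3 L"
proof -
  obtain P where P: "recursive_set 3 P" and L_sub: "L \<subseteq> word_tuples A 3"
    and dec: "\<And>us. us \<in> word_tuples A 3 \<Longrightarrow> P (map (word_code c) us) \<longleftrightarrow> us \<in> L"
    using L by (auto simp: decidable_under_def)
  let ?small = "\<lambda>x. \<forall>v\<in>set (list_decode x). v < k"
  show ?thesis
  proof (rule decidable_underI)
    have "recursive_set 3 (\<lambda>xs. P [xs ! 0, xs ! 1, xs ! 2])"
      unfolding recursive_set_def
      by (rule recursive_comp3[OF P[unfolded recursive_set_def]]) (auto intro: recursive_fn.proj)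
    then show "recursive_set 3 (\<lambda>xs. P [xs ! 0, xs ! 1, xs ! 2]
        \<and> ?small (xs ! 0) \<and> ?small (xs ! 1) \<and> ?small (xs ! 2))"
      by (intro recursive_set_conj recursive_set_all_less recursive_fn.proj) auto
    show "L \<subseteq> word_tuples C 3" using L_sub A by (auto simp: word_tuples_def)
    fix us assume us_C: "us \<in> word_tuples C 3"
    then obtain u v w where us: "us = [u, v, w]"
      and lists: "u \<in> lists C" "v \<in> lists C" "w \<in> lists C"
      by (auto simp: word_tuples_def length_Suc_conv numeral_3_eq_3)
    have small: "?small (word_code c' x) \<longleftrightarrow> x \<in> lists A" if "x \<in> lists C" for x
      using that k by (auto simp: word_code_def)
    have in_A: "us \<in> word_tuples A 3 \<longleftrightarrow> u \<in> lists A \<and> v \<in> lists A \<and> w \<in> lists A"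
      by (simp add: us word_tuples_def)
    have codes: "map (word_code c') us = map (word_code c) us" if "us \<in> word_tuples A 3"
      using that c' by (auto simp: word_tuples_def word_code_def intro!: arg_cong[of _ _ list_encode])
    have "us \<in> L \<longleftrightarrow> us \<in> word_tuples A 3 \<and> P (map (word_code c') us)"
    proof (cases "us \<in> word_tuples A 3")
      case True
      then show ?thesis unfolding codes[OF True] using dec[OF True] by simp
    qed (use L_sub in blast)
    then show "P [map (word_code c') us ! 0, map (word_code c') us ! 1, map (word_code c') us ! 2]
        \<and> ?small (map (word_code c') us ! 0) \<and> ?small (map (word_code c') us ! 1)
        \<and> ?small (map (word_code c') us ! 2) \<longleftrightarrow> us \<in> L"
      using small lists in_A by (auto simp: us)
  qed
qed

section \<open>Transfer of stacking graphs\<close>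

text \<open>
  The closure properties needed to pass from the stacking graph of \<open>H\<close> to that of \<open>G\<close>.  Both
  regular and decidable languages have them; \<open>P1\<close> concerns sets of words and \<open>P3\<close> sets of triples.
\<close>

locale tuple_language_class =
  fixes C :: "'a set" and P1 :: "'a list set \<Rightarrow> bool" and P3 :: "'a list list set \<Rightarrow> bool"
  assumes empty_language: "P1 {}" and empty_word: "P1 {[]}"
    and union1: "P1 L \<Longrightarrow> P1 M \<Longrightarrow> P1 (L \<union> M)" and union3: "P3 L' \<Longrightarrow> P3 M' \<Longrightarrow> P3 (L' \<union> M')"
    and append_letter: "P1 L \<Longrightarrow> a \<in> C \<Longrightarrow> P1 ((\<lambda>u. u @ [a]) ` L)"
    and word_section: "P3 L' \<Longrightarrow> w \<in> lists C \<Longrightarrow> w' \<in> lists C \<Longrightarrow> P1 {u. [u, w, w'] \<in> L'}"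
    and cylinder: "P1 L \<Longrightarrow> w \<in> lists C \<Longrightarrow> w' \<in> lists C \<Longrightarrow> P3 ((\<lambda>u. [u, w, w']) ` L)"
begin

lemma finite_union1: "finite I \<Longrightarrow> (\<And>i. i \<in> I \<Longrightarrow> P1 (L i)) \<Longrightarrow> P1 (\<Union>i\<in>I. L i)"
  by (induction rule: finite_induct) (auto intro: empty_language union1)

lemma finite_union3: "finite I \<Longrightarrow> (\<And>i. i \<in> I \<Longrightarrow> P3 (L i)) \<Longrightarrow> P3 (\<Union>i\<in>I. L i)"
proof (induction rule: finite_induct)
  case empty
  show ?case using cylinder[OF empty_language, of "[]" "[]"] by simp
qed (auto intro: union3)

end

context flow_extension
begin

text \<open>
  A word \<open>y\<close> is a normal form iff, for some fixed letter \<open>a\<close>, the triple \<open>(y, a, z)\<close> lies in the stacking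
  graph for some \<open>z\<close>.  Since the flow is bounded, only finitely many \<open>z\<close> come into question, so no
  projection is necessary: a finite union of sections suffices.  If \<open>A\<close> is empty, then \<open>H\<close> is trivial
  and its only normal form is the empty word.
\<close>

lemma normal_forms_in_class:
  assumes "tuple_language_class C P1 P3" and SG: "P3 (stacking_graph K A T \<Phi>)"
  shows "P1 (tree_word K T ` H)"
proof -
  interpret tuple_language_class C P1 P3 by fact
  show ?thesis
  proof (cases "A = {}")
    case True
    then have H: "H = {\<one>}" using generate_A generate_empty by simp
    moreover have "tree_word K T \<one> = []"
      using tree_word_extended(2)[OF _ one_in_S, of \<one>] True by simp
    ultimately show ?thesis using empty_word by simp
  next
    case False
    then obtain a where a: "a \<in> A" by blast
    obtain k where k: "\<forall>e\<in>H \<times> A. length (\<Phi> e) \<le> k"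
      using bounded by (auto simp: bounded_flow_def \<Gamma>\<^sub>H_simps)
    define Z where "Z = {z. set z \<subseteq> A \<and> length z \<le> k}"
    have "finite Z" unfolding Z_def using finite_A by (rule finite_lists_length_le)
    have "tree_word K T ` H = (\<Union>z\<in>Z. {u. [u, [a], z] \<in> stacking_graph K A T \<Phi>})"
    proof (intro subset_antisym subsetI)
      fix y assume "y \<in> tree_word K T ` H"
      then obtain h where h: "h \<in> H" "y = tree_word K T h" by blast
      then have ha: "(h, a) \<in> H \<times> A" using a by simp
      have "set (\<Phi> (h, a)) \<subseteq> H \<times> A"
        using flow_walk[OF ha] by (simp add: pre_digraph.awalk_def \<Gamma>\<^sub>H_simps)
      then have "map snd (\<Phi> (h, a)) \<in> Z" using k ha by (auto simp: Z_def)
      moreover have "[y, [a], map snd (\<Phi> (h, a))] \<in> stacking_graph K A T \<Phi>"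
        using h a by (auto simp: stacking_graph_def)
      ultimately show "y \<in> (\<Union>z\<in>Z. {u. [u, [a], z] \<in> stacking_graph K A T \<Phi>})" by blast
    next
      fix y assume "y \<in> (\<Union>z\<in>Z. {u. [u, [a], z] \<in> stacking_graph K A T \<Phi>})"
      then show "y \<in> tree_word K T ` H" by (auto simp: stacking_graph_def)
    qed
    moreover have "P1 (\<Union>z\<in>Z. {u. [u, [a], z] \<in> stacking_graph K A T \<Phi>})"
    proof (rule finite_union1[OF \<open>finite Z\<close>])
      fix z assume "z \<in> Z"
      then have "z \<in> lists C" "[a] \<in> lists C" using a A_subset_C by (auto simp: Z_def)
      then show "P1 {u. [u, [a], z] \<in> stacking_graph K A T \<Phi>}" using word_section[OF SG] by blast
    qed
    ultimately show ?thesis by simp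
  qed
qed

lemma stacking_graph_in_class:
  assumes "tuple_language_class C P1 P3" and SG: "P3 (stacking_graph K A T \<Phi>)"
  shows "P3 (stacking_graph G C T' \<Phi>')"
proof -
  interpret tuple_language_class C P1 P3 by fact
  have N: "P1 (tree_word K T ` H)" using assms by (rule normal_forms_in_class)
  have piece: "P3 ((\<lambda>y. [y @ letter s, [c], detour s c]) ` tree_word K T ` H)"
    if s: "s \<in> S" and c: "c \<in> C" for s c
  proof -
    have "P1 ((\<lambda>y. y @ letter s) ` tree_word K T ` H)"
    proof (cases "s = \<one>")
      case True
      then show ?thesis using N by (simp add: letter_def)
    next
      case False
      then show ?thesis using append_letter[OF N S_subset_C[OF s False]] by (simp add: letter_def)
    qed
    moreover have "[c] \<in> lists C" "detour s c \<in> lists C"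
      using detour_in_lists[OF s] c C_carrier by auto
    ultimately have "P3 ((\<lambda>u. [u, [c], detour s c]) ` (\<lambda>y. y @ letter s) ` tree_word K T ` H)"
      by (rule cylinder)
    then show ?thesis by (simp add: image_image)
  qed
  have "finite (S \<times> C - {\<one>} \<times> A)" using finite_S finite_C by simp
  then have "P3 (\<Union>(s, c)\<in>S \<times> C - {\<one>} \<times> A. (\<lambda>y. [y @ letter s, [c], detour s c]) ` tree_word K T ` H)"
    by (rule finite_union3) (auto intro: piece)
  then show ?thesis unfolding stacking_graph_extended by (rule union3[OF SG])
qed

end

lemma regular_tuple_language_class:
  assumes "finite C"
  shows "tuple_language_class C (regular_language C) (synchronously_regular C 3)"
proof
  fix L L' M M' w w' a
  show "regular_language C {}" by (rule regular_empty)
  show "regular_language C {[]}" by (rule regular_empty_word)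
  show "regular_language C L \<Longrightarrow> regular_language C M \<Longrightarrow> regular_language C (L \<union> M)"
    by (rule regular_union)
  show "synchronously_regular C 3 L' \<Longrightarrow> synchronously_regular C 3 M'
      \<Longrightarrow> synchronously_regular C 3 (L' \<union> M')"
    by (rule synchronously_regular_union)
  show "regular_language C L \<Longrightarrow> a \<in> C \<Longrightarrow> regular_language C ((\<lambda>u. u @ [a]) ` L)"
    by (rule regular_append_letter)
  have three: "3 = Suc 2" by simp
  {
    assume "w \<in> lists C" "w' \<in> lists C"
    then have ww': "[w, w'] \<in> word_tuples C 2" by (simp add: word_tuples_def)
    show "regular_language C {u. [u, w, w'] \<in> L'}" if "synchronously_regular C 3 L'"
      using regular_section[OF that[unfolded three] assms ww'] .
    show "synchronously_regular C 3 ((\<lambda>u. [u, w, w']) ` L)" if "regular_language C L"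
      unfolding three using synchronously_regular_cylinder[OF that assms ww'] .
  }
qed

lemma decidable_tuple_language_class:
  assumes "inj_on c C"
  shows "tuple_language_class C (\<lambda>L. decidable_under c C 1 ((\<lambda>u. [u]) ` L)) (decidable_under c C 3)"
proof
  let ?P1 = "\<lambda>L. decidable_under c C 1 ((\<lambda>u. [u]) ` L)" and ?P3 = "decidable_under c C 3"
  fix L L' M M' w w' a
  show "?P1 {}" using decidable_empty by simp
  show "?P1 {[]}" by (rule decidable_empty_word)
  show "?P1 L \<Longrightarrow> ?P1 M \<Longrightarrow> ?P1 (L \<union> M)"
    unfolding image_Un by (rule decidable_under_union)
  show "?P3 L' \<Longrightarrow> ?P3 M' \<Longrightarrow> ?P3 (L' \<union> M')"
    by (rule decidable_under_union)
  show "?P1 L \<Longrightarrow> a \<in> C \<Longrightarrow> ?P1 ((\<lambda>u. u @ [a]) ` L)"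
    by (rule decidable_append_letter[OF assms])
  show "?P3 L' \<Longrightarrow> w \<in> lists C \<Longrightarrow> w' \<in> lists C \<Longrightarrow> ?P1 {u. [u, w, w'] \<in> L'}"
    by (rule decidable_section)
  show "?P1 L \<Longrightarrow> w \<in> lists C \<Longrightarrow> w' \<in> lists C \<Longrightarrow> ?P3 ((\<lambda>u. [u, w, w']) ` L)"
    by (rule decidable_cylinder[OF assms])
qed

text \<open>
  The given numbering of \<open>A\<close> is kept, and the remaining letters receive numbers beyond it.
\<close>

lemma decidable_words_larger_alphabet:
  assumes dec: "decidable_words A 3 L" and A: "A \<subseteq> C" and "finite C"
  obtains c where "inj_on c C" and "decidable_under c C 3 L"
proof -
  obtain c where c: "inj_on c A" "decidable_under c A 3 L"
    using dec decidable_words_iff by blast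
  obtain e :: "'a \<Rightarrow> nat" where e: "inj_on e C"
    using finite_imp_inj_to_nat_seg[OF \<open>finite C\<close>] by blast
  have "finite (c ` A)" using \<open>finite C\<close> A finite_subset by blast
  then obtain k where k: "\<And>a. a \<in> A \<Longrightarrow> c a < k"
    using finite_nat_set_iff_bounded by auto
  define c' where "c' a = (if a \<in> A then c a else k + e a)" for a
  have "inj_on c' C"
  proof (rule inj_onI)
    fix a b assume "a \<in> C" "b \<in> C" "c' a = c' b"
    then show "a = b"
      using inj_onD[OF c(1), of a b] inj_onD[OF e, of a b] k[of a] k[of b]
      by (auto simp: c'_def split: if_splits)
  qed
  moreover have "decidable_under c' C 3 L"
    by (rule decidable_larger_alphabet[OF c(2) A, of c' k]) (auto simp: c'_def k)
  ultimately show ?thesis by (rule that)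
qed

theorem theorem3p4:
  fixes G :: "('a, 'b) monoid_scheme" and H A S C :: "'a set"
  assumes "group G"
    and "subgroup H G"
    and "finite (rcosets\<^bsub>G\<^esub> H)"
    and "generating_set (G\<lparr>carrier := H\<rparr>) A"
    and "coset_representatives G H S"
    and "\<one>\<^bsub>G\<^esub> \<in> S"
    and "C = A \<union> (\<Union>s \<in> S - {\<one>\<^bsub>G\<^esub>}. {s, inv\<^bsub>G\<^esub> s})"
  shows "generating_set G C \<and>
    (autostackable (G\<lparr>carrier := H\<rparr>) A \<longrightarrow> autostackable G C) \<and>
    (stackable (G\<lparr>carrier := H\<rparr>) A \<longrightarrow> stackable G C) \<and>
    (algorithmically_stackable (G\<lparr>carrier := H\<rparr>) A \<longrightarrow> algorithmically_stackable G C)"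
proof -
  interpret finite_index_extension G H A S C
    using assms by (simp add: finite_index_extension_def finite_index_extension_axioms_def)
  have extension: "flow_extension G H A S C T \<Phi>"
    if "maximal_tree (cayley_graph K A) T" "flow_function (cayley_graph K A) T \<Phi>"
      "bounded_flow (cayley_graph K A) \<Phi>" for T \<Phi>
    using that finite_index_extension_axioms
    by (simp add: flow_extension_def flow_extension_axioms_def tree_extension_def tree_extension_axioms_def)
  show ?thesis
  proof (intro conjI impI)
    show "generating_set G C" by (rule generating_C)
  next
    assume "stackable K A"
    then obtain T \<Phi> where "maximal_tree (cayley_graph K A) T" "flow_function (cayley_graph K A) T \<Phi>"
      "bounded_flow (cayley_graph K A) \<Phi>" by (auto simp: stackable_def)
    then interpret flow_extension G H A S C T \<Phi> by (rule extension)
    show "stackable G C"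
      using maximal_T' flow_extended bounded_extended unfolding stackable_def by blast
  next
    assume "autostackable K A"
    then obtain T \<Phi> where T\<Phi>: "maximal_tree (cayley_graph K A) T" "flow_function (cayley_graph K A) T \<Phi>"
      "bounded_flow (cayley_graph K A) \<Phi>"
      and SG: "synchronously_regular A 3 (stacking_graph K A T \<Phi>)" by (auto simp: autostackable_def)
    interpret flow_extension G H A S C T \<Phi> using T\<Phi> by (rule extension)
    have "synchronously_regular C 3 (stacking_graph G C T' \<Phi>')"
      using regular_tuple_language_class[OF finite_C] synchronously_regular_larger_alphabet[OF SG A_subset_C]
      by (rule stacking_graph_in_class)
    then show "autostackable G C"
      using maximal_T' flow_extended bounded_extended unfolding autostackable_def by blast
  next
    assume "algorithmically_stackable K A"
    then obtain T \<Phi> where T\<Phi>: "maximal_tree (cayley_graph K A) T" "flow_function (cayley_graph K A) T \<Phi>"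
      "bounded_flow (cayley_graph K A) \<Phi>"
      and SG: "decidable_words A 3 (stacking_graph K A T \<Phi>)" by (auto simp: algorithmically_stackable_def)
    interpret flow_extension G H A S C T \<Phi> using T\<Phi> by (rule extension)
    obtain c where c: "inj_on c C" "decidable_under c C 3 (stacking_graph K A T \<Phi>)"
      using decidable_words_larger_alphabet[OF SG A_subset_C finite_C] .
    have "decidable_under c C 3 (stacking_graph G C T' \<Phi>')"
      using decidable_tuple_language_class[OF c(1)] c(2) by (rule stacking_graph_in_class)
    then have "decidable_words C 3 (stacking_graph G C T' \<Phi>')"
      using c(1) decidable_words_iff by blast
    then show "algorithmically_stackable G C"
      using maximal_T' flow_extended bounded_extended unfolding algorithmically_stackable_def by blast
  qed
qed

end
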